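(* Let $(\mathcal W,S)$ be an irreducible Coxeter system with $S$ finite and let $c\in\mathcal W$ be a Coxeter element. The following are equivalent. (a) The group $\mathcal W$ is finite. (b) The set $\mathcal P(c)$ of $c$-preprojective roots is finite. (c) All positive roots are $c$-preprojective. (d) All simple roots are $c$-preprojective.
   Context: Coxeter setting. $(\mathcal W,S)$ has Coxeter matrix $(m(s,s'))_{s,s'\in S}$. Its Coxeter graph $\Gamma$ has vertex set $\Gamma_0$ with a fixed bijection $\rho:\Gamma_0\to S$; distinct vertices $x,y$ are joined by an edge (exactly one) iff $2<m(\rho(x),\rho(y))\le\infty$; irreducible means that $\Gamma$ is connected. Graph monoid. $\mathfrak M$ is the quotient of the free monoid on $\Gamma_0$ by the congruence generated by $vw\sim wv$ for all distinct $v,w\in\Gamma_0$ not joined by an edge. Its elements are written as words $X=x_l\cdots x_1$ ($x_j\in\Gamma_0$, $l\ge 0$). The letter $\rho$ also denotes the induced monoid homomorphism $\mathfrak M\to\mathcal W$. Roots. $\mathbb V$ is the real vector space with basis $\{\alpha_s\mid s\in S\}$ and symmetric bilinear form $B(\alpha_s,\alpha_{s'})=-2\cos\frac{\pi}{m(s,s')}$ (with $\frac{\pi}{\infty}=0$). $\mathcal W$ acts on $\mathbb V$ by $s\lambda=\lambda-B(\alpha_s,\lambda)\alpha_s$. The roots are the vectors $w(\alpha_s)$, $w\in\mathcal W$, $s\in S$; the $\alpha_s$ are the simple roots. A root is positive ($>0$), resp. negative ($<0$), if all its coordinates in the basis $\{\alpha_s\}$ are $\ge 0$, resp. $\le 0$.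 Coxeter element and admissible words. $c=s_n\cdots s_1$, where $s_1,\dots,s_n$ are all the elements of $S$ in some order, and $v_j=\rho^{-1}(s_j)$. The $c$-orientation of $\Gamma$ directs each edge between $v_i$ and $v_j$ with $j>i$ as $v_j\to v_i$ (it depends only on the element $c$). A sink is a vertex at which no arrow starts. A word $X=x_l\cdots x_1$ is $c$-admissible if $x_1$ is a sink for the $c$-orientation and, for $1<j\le l$, $x_j$ is a sink for the orientation obtained from the $c$-orientation by reversing all arrows incident to $x_1$, then all arrows incident to $x_2$, and so on up to $x_{j-1}$. This is well defined on elements of $\mathfrak M$; $\mathfrak M(c)\subset\mathfrak M$ is the set of $c$-admissible elements. A root $\alpha>0$ is $c$-preprojective if $\rho(X)\alpha<0$ for some $X\in\mathfrak M(c)$. $\mathcal P(c)$ is the set of $c$-preprojective roots. *)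

theory Defs
  imports
    Complex_Main
    "HOL-Library.Extended_Nat"
    "HOL-Algebra.Generated_Groups"
    "HOL-Algebra.Group_Action"
begin

section \<open>Words and presented monoids\<close>

inductive_set monoid_congruence :: "'x set \<Rightarrow> ('x list \<times> 'x list) set \<Rightarrow> ('x list \<times> 'x list) set"
  for A :: "'x set" and R :: "('x list \<times> 'x list) set"
where
  base: "\<lbrakk>(u, v) \<in> R; u \<in> lists A; v \<in> lists A\<rbrakk> \<Longrightarrow> (u, v) \<in> monoid_congruence A R"
| refl: "u \<in> lists A \<Longrightarrow> (u, u) \<in> monoid_congruence A R"
| sym: "(u, v) \<in> monoid_congruence A R \<Longrightarrow> (v, u) \<in> monoid_congruence A R"
| trans: "\<lbrakk>(u, v) \<in> monoid_congruence A R; (v, w) \<in> monoid_congruence A R\<rbrakk>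
            \<Longrightarrow> (u, w) \<in> monoid_congruence A R"
| mult: "\<lbrakk>(u, v) \<in> monoid_congruence A R; a \<in> lists A; b \<in> lists A\<rbrakk>
            \<Longrightarrow> (a @ u @ b, a @ v @ b) \<in> monoid_congruence A R"

definition word_prod :: "('w, 'b) monoid_scheme \<Rightarrow> 'w list \<Rightarrow> 'w" where
  "word_prod G ws = foldr (mult G) ws \<one>\<^bsub>G\<^esub>"

section \<open>Coxeter systems and Coxeter graphs\<close>

definition coxeter_matrix :: "'w set \<Rightarrow> ('w \<Rightarrow> 'w \<Rightarrow> enat) \<Rightarrow> bool" where
  "coxeter_matrix S m \<longleftrightarrow>
     (\<forall>s\<in>S. \<forall>t\<in>S. m s t = m t s \<and> (if s = t then m s t = 1 else 2 \<le> m s t))"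

definition coxeter_relations :: "'w set \<Rightarrow> ('w \<Rightarrow> 'w \<Rightarrow> enat) \<Rightarrow> ('w list \<times> 'w list) set" where
  "coxeter_relations S m =
     {(concat (replicate k [s, t]), []) | s t k. s \<in> S \<and> t \<in> S \<and> m s t = enat k}"

text \<open>
  The last two conjuncts say that G has the presentation with generators S and relations
  (st)^m(s,t) = 1 for m(s,t) finite. Since m(s,s) = 1, the relations contain ss = 1 for every
  generator, so the monoid with this presentation is already the group with this presentation
  and no formal inverses of the letters are needed.
\<close>
definition coxeter_system ::
  "('w, 'b) monoid_scheme \<Rightarrow> 'w set \<Rightarrow> ('w \<Rightarrow> 'w \<Rightarrow> enat) \<Rightarrow> bool" where
  "coxeter_system G S m \<longleftrightarrow>
     group G \<and> S \<subseteq> carrier G \<and> coxeter_matrix S m \<and>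
     generate G S = carrier G \<and>
     (\<forall>u\<in>lists S. \<forall>v\<in>lists S.
        word_prod G u = word_prod G v \<longleftrightarrow> (u, v) \<in> monoid_congruence S (coxeter_relations S m))"

definition coxeter_edges ::
  "('w \<Rightarrow> 'w \<Rightarrow> enat) \<Rightarrow> 'v set \<Rightarrow> ('v \<Rightarrow> 'w) \<Rightarrow> ('v \<times> 'v) set" where
  "coxeter_edges m V0 \<rho> = {(x, y). x \<in> V0 \<and> y \<in> V0 \<and> x \<noteq> y \<and> 2 < m (\<rho> x) (\<rho> y)}"

definition coxeter_irreducible ::
  "('w \<Rightarrow> 'w \<Rightarrow> enat) \<Rightarrow> 'v set \<Rightarrow> ('v \<Rightarrow> 'w) \<Rightarrow> bool" where
  "coxeter_irreducible m V0 \<rho> \<longleftrightarrow> (\<forall>x\<in>V0. \<forall>y\<in>V0. (x, y) \<in> (coxeter_edges m V0 \<rho>)\<^sup>*)"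

section \<open>The graph monoid\<close>

definition graph_relations ::
  "('w \<Rightarrow> 'w \<Rightarrow> enat) \<Rightarrow> 'v set \<Rightarrow> ('v \<Rightarrow> 'w) \<Rightarrow> ('v list \<times> 'v list) set" where
  "graph_relations m V0 \<rho> =
     {([v, w], [w, v]) | v w. v \<in> V0 \<and> w \<in> V0 \<and> v \<noteq> w \<and> (v, w) \<notin> coxeter_edges m V0 \<rho>}"

abbreviation graph_congruence ::
  "('w \<Rightarrow> 'w \<Rightarrow> enat) \<Rightarrow> 'v set \<Rightarrow> ('v \<Rightarrow> 'w) \<Rightarrow> ('v list \<times> 'v list) set" where
  "graph_congruence m V0 \<rho> \<equiv> monoid_congruence V0 (graph_relations m V0 \<rho>)"

definition graph_monoid ::
  "('w \<Rightarrow> 'w \<Rightarrow> enat) \<Rightarrow> 'v set \<Rightarrow> ('v \<Rightarrow> 'w) \<Rightarrow> 'v list set monoid" where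
  "graph_monoid m V0 \<rho> =
     \<lparr>carrier = lists V0 // graph_congruence m V0 \<rho>,
      mult = (\<lambda>X Y. graph_congruence m V0 \<rho> `` {x @ y | x y. x \<in> X \<and> y \<in> Y}),
      one = graph_congruence m V0 \<rho> `` {[]}\<rparr>"

text \<open>
  The homomorphism from the graph monoid to the Coxeter group induced by \<open>\<rho>\<close>: all words in the
  class X have the same value, since s and t commute when m(s,t) = 2.
\<close>
definition induced_hom ::
  "('w, 'b) monoid_scheme \<Rightarrow> ('v \<Rightarrow> 'w) \<Rightarrow> 'v list set \<Rightarrow> 'w" where
  "induced_hom G \<rho> X = the_elem ((\<lambda>x. word_prod G (map \<rho> x)) ` X)"

section \<open>Geometric representation and roots\<close>

text \<open>
  A vector is represented by its coordinate function with respect to the basis of simple roots.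
  All of this is used for finite S only, so no finite-support condition is imposed.
\<close>
definition root_space :: "'w set \<Rightarrow> ('w \<Rightarrow> real) set" where
  "root_space S = {v. \<forall>s. s \<notin> S \<longrightarrow> v s = 0}"

definition simple_root :: "'w \<Rightarrow> 'w \<Rightarrow> real" where
  "simple_root s = (\<lambda>t. if t = s then 1 else 0)"

definition coxeter_form ::
  "'w set \<Rightarrow> ('w \<Rightarrow> 'w \<Rightarrow> enat) \<Rightarrow> ('w \<Rightarrow> real) \<Rightarrow> ('w \<Rightarrow> real) \<Rightarrow> real" where
  "coxeter_form S m u v =
     (\<Sum>s\<in>S. \<Sum>t\<in>S. u s * v t *
        (- 2 * cos (case m s t of enat k \<Rightarrow> pi / real k | \<infinity> \<Rightarrow> 0)))"

text \<open>
  The action of the Coxeter group on the root space. As S generates G, an action is determined on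
  the carrier by the condition on S; it exists because the reflections satisfy the defining
  relations.
\<close>
definition geometric_action ::
  "('w, 'b) monoid_scheme \<Rightarrow> 'w set \<Rightarrow> ('w \<Rightarrow> 'w \<Rightarrow> enat) \<Rightarrow> 'w \<Rightarrow> ('w \<Rightarrow> real) \<Rightarrow> 'w \<Rightarrow> real"
where
  "geometric_action G S m =
     (SOME \<phi>. group_action G (root_space S) \<phi> \<and>
        (\<forall>s\<in>S. \<forall>v\<in>root_space S.
           \<phi> s v = (\<lambda>t. v t - coxeter_form S m (simple_root s) v * simple_root s t)))"

definition roots ::
  "('w, 'b) monoid_scheme \<Rightarrow> 'w set \<Rightarrow> ('w \<Rightarrow> 'w \<Rightarrow> enat) \<Rightarrow> ('w \<Rightarrow> real) set" where
  "roots G S m = {geometric_action G S m w (simple_root s) | w s. w \<in> carrier G \<and> s \<in> S}"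

definition positive_roots ::
  "('w, 'b) monoid_scheme \<Rightarrow> 'w set \<Rightarrow> ('w \<Rightarrow> 'w \<Rightarrow> enat) \<Rightarrow> ('w \<Rightarrow> real) set" where
  "positive_roots G S m = {\<alpha> \<in> roots G S m. \<forall>s\<in>S. 0 \<le> \<alpha> s}"

definition negative_roots ::
  "('w, 'b) monoid_scheme \<Rightarrow> 'w set \<Rightarrow> ('w \<Rightarrow> 'w \<Rightarrow> enat) \<Rightarrow> ('w \<Rightarrow> real) set" where
  "negative_roots G S m = {\<alpha> \<in> roots G S m. \<forall>s\<in>S. \<alpha> s \<le> 0}"

section \<open>Coxeter elements and admissible words\<close>

text \<open>
  Words are lists in reading order: the list representing a product of letters indexed n, ..., 1
  begins with the letter of index n and ends with the letter of index 1.
\<close>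
definition coxeter_expression ::
  "('w, 'b) monoid_scheme \<Rightarrow> 'w set \<Rightarrow> 'w \<Rightarrow> 'w list \<Rightarrow> bool" where
  "coxeter_expression G S c ss \<longleftrightarrow> distinct ss \<and> set ss = S \<and> word_prod G ss = c"

definition coxeter_element :: "('w, 'b) monoid_scheme \<Rightarrow> 'w set \<Rightarrow> 'w \<Rightarrow> bool" where
  "coxeter_element G S c \<longleftrightarrow> (\<exists>ss. coxeter_expression G S c ss)"

text \<open>
  Orientations are sets of arrows (source, target). An edge is directed from the letter standing
  further to the left in the expression (the larger index) to the one further to the right.
\<close>
definition word_orientation ::
  "('w \<Rightarrow> 'w \<Rightarrow> enat) \<Rightarrow> 'v set \<Rightarrow> ('v \<Rightarrow> 'w) \<Rightarrow> 'w list \<Rightarrow> ('v \<times> 'v) set" where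
  "word_orientation m V0 \<rho> ss =
     {(x, y) \<in> coxeter_edges m V0 \<rho>. \<exists>i j. i < j \<and> j < length ss \<and> ss ! i = \<rho> x \<and> ss ! j = \<rho> y}"

text \<open>All expressions of c as a Coxeter element give the same orientation.\<close>
definition c_orientation ::
  "('w, 'b) monoid_scheme \<Rightarrow> 'w set \<Rightarrow> ('w \<Rightarrow> 'w \<Rightarrow> enat) \<Rightarrow> 'v set \<Rightarrow> ('v \<Rightarrow> 'w) \<Rightarrow> 'w
     \<Rightarrow> ('v \<times> 'v) set" where
  "c_orientation G S m V0 \<rho> c = word_orientation m V0 \<rho> (SOME ss. coxeter_expression G S c ss)"

definition is_sink :: "'v set \<Rightarrow> ('v \<times> 'v) set \<Rightarrow> 'v \<Rightarrow> bool" where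
  "is_sink V0 D x \<longleftrightarrow> x \<in> V0 \<and> (\<forall>y. (x, y) \<notin> D)"

definition reverse_at :: "'v \<Rightarrow> ('v \<times> 'v) set \<Rightarrow> ('v \<times> 'v) set" where
  "reverse_at x D = {(a, b). if a = x \<or> b = x then (b, a) \<in> D else (a, b) \<in> D}"

text \<open>The sequence lists the letters in the order in which they are processed, from right to left
  in the word; the empty word is admissible.\<close>
fun sink_sequence :: "'v set \<Rightarrow> ('v \<times> 'v) set \<Rightarrow> 'v list \<Rightarrow> bool" where
  "sink_sequence V0 D [] \<longleftrightarrow> True"
| "sink_sequence V0 D (x # xs) \<longleftrightarrow> is_sink V0 D x \<and> sink_sequence V0 (reverse_at x D) xs"

definition admissible_word ::
  "('w, 'b) monoid_scheme \<Rightarrow> 'w set \<Rightarrow> ('w \<Rightarrow> 'w \<Rightarrow> enat) \<Rightarrow> 'v set \<Rightarrow> ('v \<Rightarrow> 'w) \<Rightarrow> 'w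
     \<Rightarrow> 'v list \<Rightarrow> bool" where
  "admissible_word G S m V0 \<rho> c xs \<longleftrightarrow> sink_sequence V0 (c_orientation G S m V0 \<rho> c) (rev xs)"

text \<open>Admissibility is invariant under the congruence, so one representative decides.\<close>
definition admissible_elements ::
  "('w, 'b) monoid_scheme \<Rightarrow> 'w set \<Rightarrow> ('w \<Rightarrow> 'w \<Rightarrow> enat) \<Rightarrow> 'v set \<Rightarrow> ('v \<Rightarrow> 'w) \<Rightarrow> 'w
     \<Rightarrow> 'v list set set" where
  "admissible_elements G S m V0 \<rho> c =
     {X \<in> carrier (graph_monoid m V0 \<rho>). \<exists>x\<in>X. admissible_word G S m V0 \<rho> c x}"

definition preprojective_roots ::
  "('w, 'b) monoid_scheme \<Rightarrow> 'w set \<Rightarrow> ('w \<Rightarrow> 'w \<Rightarrow> enat) \<Rightarrow> 'v set \<Rightarrow> ('v \<Rightarrow> 'w) \<Rightarrow> 'w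
     \<Rightarrow> ('w \<Rightarrow> real) set" where
  "preprojective_roots G S m V0 \<rho> c =
     {\<alpha> \<in> positive_roots G S m. \<exists>X\<in>admissible_elements G S m V0 \<rho> c.
        geometric_action G S m (induced_hom G \<rho> X) \<alpha> \<in> negative_roots G S m}"

end

theory Submission
  imports Defs
begin

text \<open>
  An admissible word processes letters \<open>x\<^sub>1, x\<^sub>2, \<dots>\<close>; its inversions are the roots
  \<open>x\<^sub>1 \<dots> x\<^sub>k\<^sub>-\<^sub>1 \<alpha>\<close> with \<open>\<alpha>\<close> the simple root of \<open>x\<^sub>k\<close>. Call a letter inverted if the inverse of the
  word makes its simple root negative. The Euler form of the current orientation is preserved by reflecting at a sink, and
  it shows, as long as all inversions of the word are positive, that inversion of \<open>u\<close> and an arrow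
  \<open>v \<rightarrow> u\<close> force inversion of \<open>v\<close>. So if only non-inverted sinks are processed, the process can stop
  only when every letter is inverted, and then the group is finite. For finite \<open>W\<close> this produces one
  admissible word making all positive roots negative.

  For infinite \<open>W\<close> every admissible word has only positive inversions: an inverted sink would stay a
  sink and stay inverted while the other letters are processed, and by connectedness it blocks the
  process after boundedly many steps. Hence there are infinitely many preprojective roots, and the
  Euler form shows that the simple root at a source is not one of them. The argument is close to
  Speyer's proof that powers of Coxeter elements in infinite irreducible groups are reduced.
\<close>

section \<open>Reflections and the action of words\<close>

definition coxeter_coeff :: "('w \<Rightarrow> 'w \<Rightarrow> enat) \<Rightarrow> 'w \<Rightarrow> 'w \<Rightarrow> real" where
  "coxeter_coeff m s t = - 2 * cos (case m s t of enat k \<Rightarrow> pi / real k | \<infinity> \<Rightarrow> 0)"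

text \<open>The last letter is \<open>a\<close> for every length, because the rightmost letter of a
  word acts first; the first letter depends on the parity.\<close>

fun alternating :: "'a \<Rightarrow> 'a \<Rightarrow> nat \<Rightarrow> 'a list" where
  "alternating a b 0 = []"
| "alternating a b (Suc k) = alternating b a k @ [a]"

lemma alternating_Cons: "alternating a b (Suc k) = (if even k then a else b) # alternating a b k"
  by (induction k arbitrary: a b) auto

lemma length_alternating [simp]: "length (alternating a b k) = k"
  by (induction k arbitrary: a b) auto

lemma set_alternating: "set (alternating a b k) \<subseteq> {a, b}"
  by (induction k arbitrary: a b) auto

lemma alternating_add: "\<exists>p. alternating a b (i + j) = p @ alternating a b j \<and> length p = i \<and> set p \<subseteq> {a, b}"
proof (induction i)
  case (Suc i)
  then obtain p where "alternating a b (i + j) = p @ alternating a b j" "length p = i" "set p \<subseteq> {a, b}"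
    by blast
  then show ?case
    using alternating_Cons[of a b "i + j"]
    by (intro exI[of _ "(if even (i + j) then a else b) # p"]) auto
qed auto

lemma alternating_even: "alternating t s (2 * k) = concat (replicate k [s, t])"
proof (induction k)
  case (Suc k)
  have "alternating t s (2 * Suc k) = [s, t] @ alternating t s (2 * k)"
    using alternating_Cons[of t s "Suc (2 * k)"] alternating_Cons[of t s "2 * k"] by simp
  then show ?case using Suc by simp
qed simp

text \<open>The coefficients of the alternating products on the plane spanned by two simple roots are
  Chebyshev polynomials of the second kind, with \<open>p = 2 cos \<theta>\<close>.\<close>
fun chebyshev :: "real \<Rightarrow> nat \<Rightarrow> real" where
  "chebyshev p 0 = 0"
| "chebyshev p (Suc 0) = 1"
| "chebyshev p (Suc (Suc k)) = p * chebyshev p (Suc k) - chebyshev p k"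

text \<open>Add the expansions of sin ((k + 1) \<theta> + \<theta>) and sin ((k + 1) \<theta> -
  \<theta>). The factor sin \<theta> is kept on the left, so nothing is divided by it.\<close>

lemma chebyshev_cos: "chebyshev (2 * cos \<theta>) k * sin \<theta> = sin (real k * \<theta>)"
proof (induction "2 * cos \<theta>" k rule: chebyshev.induct)
  case (3 k)
  have a: "sin (real (Suc (Suc k)) * \<theta>) = sin (real (Suc k) * \<theta> + \<theta>)"
    and b: "sin (real k * \<theta>) = sin (real (Suc k) * \<theta> - \<theta>)"
    by (simp_all add: algebra_simps)
  have "sin (real (Suc (Suc k)) * \<theta>) = 2 * cos \<theta> * sin (real (Suc k) * \<theta>) - sin (real k * \<theta>)"
    unfolding a b sin_add sin_diff by simp
  then show ?case using 3 by (simp add: algebra_simps)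
qed simp_all

text \<open>Needed for infinite \<open>m s t\<close>, where \<open>- b s t\<close> is 2.\<close>

lemma chebyshev_two: "chebyshev 2 k = real k"
  by (induction "2 :: real" k rule: chebyshev.induct) auto

declare in_lists_conv_set [simp] ball_Un [simp]

lemma word_prod_Nil [simp]: "word_prod G [] = \<one>\<^bsub>G\<^esub>"
  and word_prod_Cons [simp]: "word_prod G (a # u) = a \<otimes>\<^bsub>G\<^esub> word_prod G u"
  by (simp_all add: word_prod_def)

locale finite_coxeter_system =
  fixes G :: "('w, 'b) monoid_scheme" (structure) and S :: "'w set" and m :: "'w \<Rightarrow> 'w \<Rightarrow> enat"
  assumes coxeter_system: "coxeter_system G S m" and finite_S: "finite S"
begin

sublocale group G
  using coxeter_system by (simp add: coxeter_system_def)

lemma S_carrier: "S \<subseteq> carrier G"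
  using coxeter_system by (simp add: coxeter_system_def)

section \<open>The bilinear form and the simple reflections\<close>

abbreviation "b \<equiv> coxeter_coeff m"
abbreviation "form \<equiv> coxeter_form S m"

lemma m_sym: "s \<in> S \<Longrightarrow> t \<in> S \<Longrightarrow> m s t = m t s"
  and m_diag: "s \<in> S \<Longrightarrow> m s s = 1"
  and m_ge: "s \<in> S \<Longrightarrow> t \<in> S \<Longrightarrow> s \<noteq> t \<Longrightarrow> 2 \<le> m s t"
  using coxeter_system by (auto simp: coxeter_system_def coxeter_matrix_def)

lemma b_sym: "s \<in> S \<Longrightarrow> t \<in> S \<Longrightarrow> b s t = b t s"
  by (simp add: coxeter_coeff_def m_sym)

lemma b_diag [simp]: "s \<in> S \<Longrightarrow> b s s = 2"
  by (simp add: coxeter_coeff_def m_diag one_enat_def)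

lemma b_commuting: "m s t = 2 \<Longrightarrow> b s t = 0"
  by (simp add: coxeter_coeff_def numeral_eq_enat)

lemma b_neg: assumes "2 < m s t" shows "b s t < 0"
proof (cases "m s t")
  case (enat k)
  then have k: "2 < k" using assms by (simp add: numeral_eq_enat)
  have "cos (pi / real k) > 0"
    by (rule cos_gt_zero) (use k in \<open>auto simp: field_simps\<close>)
  then show ?thesis using enat by (simp add: coxeter_coeff_def)
qed (simp add: coxeter_coeff_def)

lemma form_simple_left: "s \<in> S \<Longrightarrow> form (simple_root s) v = (\<Sum>t\<in>S. b s t * v t)"
  unfolding coxeter_form_def simple_root_def coxeter_coeff_def
  by (subst sum.swap) (simp add: finite_S if_distrib if_distribR sum.delta mult.commute cong: if_cong)

lemma form_simple [simp]: "s \<in> S \<Longrightarrow> t \<in> S \<Longrightarrow> form (simple_root s) (simple_root t) = b s t"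
  by (simp add: form_simple_left) (simp add: simple_root_def finite_S if_distrib sum.delta cong: if_cong)

lemma form_lin_right: "form u (\<lambda>t. x * v t + y * w t) = x * form u v + y * form u w"
  unfolding coxeter_form_def sum_distrib_left sum.distrib[symmetric]
  by (intro sum.cong HOL.refl) (simp add: algebra_simps)

lemma form_diff_right: "form u (\<lambda>t. v t - y * w t) = form u v - y * form u w"
  using form_lin_right[of u 1 v "- y" w] by simp

lemma form_sym: "form u v = form v u"
proof -
  have "form u v = (\<Sum>t\<in>S. \<Sum>s\<in>S. u s * v t * b s t)"
    unfolding coxeter_form_def coxeter_coeff_def by (rule sum.swap)
  also have "\<dots> = form v u"
    unfolding coxeter_form_def coxeter_coeff_def[symmetric]
    by (intro sum.cong HOL.refl) (simp add: b_sym)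
  finally show ?thesis .
qed

definition reflect :: "'w \<Rightarrow> ('w \<Rightarrow> real) \<Rightarrow> 'w \<Rightarrow> real" where
  "reflect s v = (\<lambda>t. v t - form (simple_root s) v * simple_root s t)"

text \<open>The action is set up on words, the last letter acting first; by \<open>act_cong\<close>
  it depends only on the group element.\<close>

abbreviation act :: "'w list \<Rightarrow> ('w \<Rightarrow> real) \<Rightarrow> 'w \<Rightarrow> real" where
  "act u \<equiv> foldr reflect u"

lemma reflect_lin: "reflect s (\<lambda>t. x * v t + y * w t) = (\<lambda>t. x * reflect s v t + y * reflect s w t)"
  by (simp add: reflect_def form_lin_right algebra_simps)

lemma act_lin: "act u (\<lambda>t. x * v t + y * w t) = (\<lambda>t. x * act u v t + y * act u w t)"
  by (induction u) (simp_all add: reflect_lin)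

lemma reflect_minus: "reflect s (\<lambda>t. - v t) = (\<lambda>t. - reflect s v t)"
  using reflect_lin[of s "- 1" v 0 v] by simp

lemma act_minus: "act u (\<lambda>t. - v t) = (\<lambda>t. - act u v t)"
  using act_lin[of u "- 1" v 0 v] by simp

lemma reflect_simple_self: "s \<in> S \<Longrightarrow> reflect s (simple_root s) = (\<lambda>t. - simple_root s t)"
  by (simp add: reflect_def)

lemma reflect_reflect [simp]: assumes "s \<in> S" shows "reflect s (reflect s v) = v"
proof -
  have "form (simple_root s) (reflect s v) = - form (simple_root s) v"
    using assms unfolding reflect_def form_diff_right by simp
  then show ?thesis by (simp add: reflect_def)
qed

lemma form_reflect: assumes "s \<in> S" shows "form (reflect s u) (reflect s v) = form u v"
proof -
  have "form (reflect s u) (reflect s v) = form (reflect s u) v - form (simple_root s) v * form (reflect s u) (simple_root s)"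
    unfolding reflect_def[of s v] form_diff_right ..
  moreover have "form v (reflect s u) = form v u - form (simple_root s) u * form v (simple_root s)"
    unfolding reflect_def[of s u] form_diff_right ..
  moreover have "form (simple_root s) (reflect s u) = - form (simple_root s) u"
    using assms unfolding reflect_def[of s u] form_diff_right by simp
  ultimately show ?thesis
    using form_sym[of "reflect s u" v] form_sym[of u v] form_sym[of "reflect s u" "simple_root s"]
      form_sym[of v "simple_root s"] by simp
qed

lemma form_act: "u \<in> lists S \<Longrightarrow> form (act u x) (act u y) = form x y"
  by (induction u) (auto simp: form_reflect)

lemma act_rev [simp]: "u \<in> lists S \<Longrightarrow> act u (act (rev u) v) = v"
  and rev_act [simp]: "u \<in> lists S \<Longrightarrow> act (rev u) (act u v) = v"
proof -
  show *: "act u (act (rev u) v) = v" if "u \<in> lists S" for u v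
    using that by (induction u arbitrary: v) auto
  show "u \<in> lists S \<Longrightarrow> act (rev u) (act u v) = v"
    using *[of "rev u" v] by simp
qed

text \<open>A letter added on the left keeps one of the two coefficients and replaces the other by
  the next term of the Chebyshev recursion with parameter \<open>- b s t\<close>.\<close>

lemma act_alternating:
  assumes "s \<in> S" "t \<in> S" "s \<noteq> t"
  shows "act (alternating t s k) (simple_root s) =
    (if even k then (\<lambda>x. chebyshev (- b s t) (Suc k) * simple_root s x + chebyshev (- b s t) k * simple_root t x)
     else (\<lambda>x. chebyshev (- b s t) k * simple_root s x + chebyshev (- b s t) (Suc k) * simple_root t x))"
proof (induction k)
  case 0
  show ?case by simp
next
  case (Suc k)
  have s: "reflect s (simple_root s) = (\<lambda>x. - simple_root s x)"
    "reflect t (simple_root t) = (\<lambda>x. - simple_root t x)"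
    "reflect s (simple_root t) = (\<lambda>x. simple_root t x - b s t * simple_root s x)"
    "reflect t (simple_root s) = (\<lambda>x. simple_root s x - b s t * simple_root t x)"
    using assms b_sym[of s t] by (auto simp: reflect_def)
  show ?case
    unfolding alternating_Cons
    by (cases "even k") (simp_all add: Suc reflect_lin s, simp_all add: fun_eq_iff algebra_simps)
qed

lemma b_enat: "m s t = enat k \<Longrightarrow> - b s t = 2 * cos (pi / real k)"
  by (simp add: coxeter_coeff_def)

text \<open>The word is \<open>alternating t s (2 * k)\<close>. At the angle \<pi> / k the Chebyshev
  values with indices \<open>2 * k\<close> and \<open>Suc (2 * k)\<close> are 0 and 1, since the
  sine has period 2 \<pi>.\<close>

lemma act_braid_simple:
  assumes "s \<in> S" "t \<in> S" "s \<noteq> t" "m s t = enat k"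
  shows "act (concat (replicate k [s, t])) (simple_root s) = simple_root s"
proof -
  have k: "2 \<le> k" using m_ge[of s t] assms by (simp add: numeral_eq_enat)
  then have sp: "sin (pi / real k) > 0" by (intro sin_gt_zero) (auto simp: field_simps)
  have kk: "real (2 * k) * (pi / real k) = 2 * pi" "real (Suc (2 * k)) * (pi / real k) = pi / real k + 2 * pi"
    using k by (simp_all add: field_simps)
  have "chebyshev (- b s t) (2 * k) * sin (pi / real k) = 0"
    "chebyshev (- b s t) (Suc (2 * k)) * sin (pi / real k) = sin (pi / real k)"
    unfolding b_enat[OF assms(4)] chebyshev_cos kk by (simp_all only: sin_two_pi sin_periodic)
  then have "chebyshev (- b s t) (2 * k) = 0" "chebyshev (- b s t) (Suc (2 * k)) = 1"
    using sp by auto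
  then show ?thesis
    using act_alternating[OF assms(1-3), of "2 * k"] by (simp add: alternating_even)
qed

lemma rev_concat_replicate: "rev (concat (replicate k [s, t])) = concat (replicate k [t, s])"
proof (induction k)
  case (Suc k)
  have "concat (replicate k [t, s]) @ [t, s] = [t, s] @ concat (replicate k [t, s])"
    by (induction k) auto
  then show ?case using Suc by simp
qed simp

text \<open>For \<open>s \<noteq> t\<close> the form is nondegenerate on the plane of the two simple roots, and the
  orthogonal complement of this plane is fixed.\<close>
lemma act_braid:
  assumes "s \<in> S" "t \<in> S" "m s t = enat k"
  shows "act (concat (replicate k [s, t])) v = v"
proof (cases "s = t")
  case True
  then show ?thesis
    using m_diag[OF assms(1)] assms by (auto simp: one_enat_def)
next
  case False
  let ?u = "concat (replicate k [s, t])"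
  have "set ?u \<subseteq> {s, t}" by auto
  then have u: "?u \<in> lists S" using assms(1,2) by auto
  have k: "2 \<le> k" using m_ge[of s t] assms False by (simp add: numeral_eq_enat)
  then have sp: "sin (pi / real k) > 0" by (intro sin_gt_zero) (auto simp: field_simps)
  define c where "c = cos (pi / real k)"
  have "c\<^sup>2 \<noteq> 1" using sp sin_squared_eq[of "pi / real k"] by (auto simp: c_def)
  then have c: "1 - c * c \<noteq> 0" by (simp add: power2_eq_square)
  have b: "b s t = - 2 * c" "b t s = - 2 * c"
    using b_enat[OF assms(3)] b_sym[OF assms(1,2)] by (auto simp: c_def)
  define p q where "p = form (simple_root s) v" and "q = form (simple_root t) v"
  \<comment> \<open>Coordinates of the orthogonal projection of \<open>v\<close> to the plane, by
    Cramer's rule; the Gram determinant is \<open>4 * (1 - c * c)\<close>.\<close>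
  define x y where "x = (p + c * q) / (2 * (1 - c * c))" and "y = (q + c * p) / (2 * (1 - c * c))"
  define w where "w = (\<lambda>i. 1 * (v i - x * simple_root s i) - y * simple_root t i)"
  have v: "v = (\<lambda>i. 1 * w i + 1 * (x * simple_root s i + y * simple_root t i))"
    by (simp add: w_def)
  have xy: "2 * x - 2 * c * y = p" "2 * y - 2 * c * x = q"
    using c by (simp_all add: x_def y_def divide_simps) (simp_all add: algebra_simps)
  have orth: "form (simple_root s) w = 0" "form (simple_root t) w = 0"
    unfolding w_def using xy assms(1,2) b
    by (simp_all add: form_diff_right flip: p_def q_def) (simp_all add: algebra_simps)
  have "act us w = w" if "set us \<subseteq> {s, t}" for us
    using that by (induction us) (auto simp: reflect_def orth)
  then have w: "act ?u w = w" using \<open>set ?u \<subseteq> {s, t}\<close> by blast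
  have s: "act ?u (simple_root s) = simple_root s"
    by (rule act_braid_simple) (use assms False in auto)
  \<comment> \<open>Reversal exchanges the two letters, so the preceding lemma also applies to
    \<open>t\<close>. A vector fixed by the inverse word is fixed by the word.\<close>
  have "act (rev ?u) (simple_root t) = simple_root t"
    unfolding rev_concat_replicate
    by (rule act_braid_simple) (use assms False m_sym in auto)
  then have t: "act ?u (simple_root t) = simple_root t"
    using act_rev[OF u, of "simple_root t"] by simp
  show ?thesis
    by (subst (1 2) v) (simp only: act_lin w s t)
qed

section \<open>Words and group elements\<close>

abbreviation P :: "'w list \<Rightarrow> 'w" where "P \<equiv> word_prod G"

lemma P_closed [simp]: "u \<in> lists S \<Longrightarrow> P u \<in> carrier G"
  by (induction u) (use S_carrier in auto)

lemma P_append: "u \<in> lists S \<Longrightarrow> v \<in> lists S \<Longrightarrow> P (u @ v) = P u \<otimes> P v"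
  by (induction u) (use S_carrier in \<open>auto simp: m_assoc subset_iff\<close>)

lemma P_eq_iff: "u \<in> lists S \<Longrightarrow> v \<in> lists S \<Longrightarrow>
    P u = P v \<longleftrightarrow> (u, v) \<in> monoid_congruence S (coxeter_relations S m)"
  using coxeter_system by (simp add: coxeter_system_def)

lemma P_append_cong:
  assumes "P u = P u'" "P v = P v'" "u \<in> lists S" "u' \<in> lists S" "v \<in> lists S" "v' \<in> lists S"
  shows "P (u @ v) = P (u' @ v')"
  using assms by (simp add: P_append del: append_in_lists_conv)

lemma P_braid:
  assumes "s \<in> S" "t \<in> S" "m s t = enat k"
  shows "P (concat (replicate k [s, t])) = P []"
proof -
  have "concat (replicate k [s, t]) \<in> lists S"
    by (induction k) (use assms in auto)
  then show ?thesis
    using assms by (subst P_eq_iff) (auto intro!: monoid_congruence.base simp: coxeter_relations_def)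
qed

lemma P_square: "s \<in> S \<Longrightarrow> P [s, s] = P []"
  using P_braid[of s s 1] m_diag[of s] by (simp add: one_enat_def)

lemma P_cancel: "s \<in> S \<Longrightarrow> u \<in> lists S \<Longrightarrow> v \<in> lists S \<Longrightarrow> P (u @ [s, s] @ v) = P (u @ v)"
  by (metis P_append_cong P_square append_in_lists_conv append_Nil lists.intros)

lemma P_rev: "u \<in> lists S \<Longrightarrow> P u \<otimes> P (rev u) = \<one>"
proof (induction u)
  case (Cons s u)
  have "P (s # u) \<otimes> P (rev (s # u)) = P ([s] @ (u @ rev u) @ [s])"
    using Cons by (subst P_append[symmetric]) auto
  also have "\<dots> = P ([s] @ [] @ [s])"
    using Cons by (intro P_append_cong HOL.refl) (auto simp: P_append)
  finally show ?case using P_square Cons by simp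
qed auto

text \<open>Every generator is its own inverse, so words without formal inverses exhaust the
  generated group.\<close>

lemma carrier_eq: "carrier G = P ` lists S"
proof
  show "P ` lists S \<subseteq> carrier G" using P_closed by blast
  have "g \<in> P ` lists S" if "g \<in> generate G S" for g
    using that
  proof (induction rule: generate.induct)
    case one
    show ?case by (intro image_eqI[of _ _ "[]"]) auto
  next
    case (incl h)
    then show ?case using S_carrier by (intro image_eqI[of _ _ "[h]"]) auto
  next
    case (inv h)
    have "h \<otimes> h = \<one>" using P_square[OF inv] inv S_carrier by auto
    then have "inv h = h" using inv S_carrier by (intro inv_equality) auto
    then show ?case using inv S_carrier by (intro image_eqI[of _ _ "[h]"]) auto
  next
    case (eng h1 h2)
    then obtain u v where "h1 = P u" "u \<in> lists S" "h2 = P v" "v \<in> lists S" by auto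
    then show ?case by (intro image_eqI[of _ _ "u @ v"]) (auto simp: P_append)
  qed
  then show "carrier G \<subseteq> P ` lists S"
    using coxeter_system by (auto simp: coxeter_system_def)
qed

text \<open>Induction over the congruence generated by the Coxeter relations; the relations
  themselves act trivially by \<open>act_braid\<close>.\<close>

lemma act_cong:
  assumes "P u = P v" "u \<in> lists S" "v \<in> lists S"
  shows "act u = act v"
proof -
  have "(u, v) \<in> monoid_congruence S (coxeter_relations S m)"
    using assms P_eq_iff by blast
  then show ?thesis
  proof (induction rule: monoid_congruence.induct)
    case (base u v)
    then show ?case using act_braid by (fastforce simp: coxeter_relations_def fun_eq_iff)
  qed auto
qed

text \<open>An arbitrary representing word; by \<open>act_cong\<close> the choice does not affect
  the action.\<close>

definition word_of :: "'w \<Rightarrow> 'w list" where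
  "word_of g = (SOME u. u \<in> lists S \<and> P u = g)"

lemma act_word_of: "u \<in> lists S \<Longrightarrow> act (word_of (P u)) = act u"
  unfolding word_of_def by (rule someI2[of _ u]) (auto intro!: act_cong)

lemma act_root_space: "u \<in> lists S \<Longrightarrow> v \<in> root_space S \<Longrightarrow> act u v \<in> root_space S"
  by (induction u) (auto simp: root_space_def reflect_def simple_root_def)

lemma simple_root_space: "s \<in> S \<Longrightarrow> simple_root s \<in> root_space S"
  by (auto simp: root_space_def simple_root_def)

text \<open>The witness for the choice in \<open>geometric_action\<close> lets a group element act
  through any word for it. The maps are restricted to the root space because the elements of
  \<open>BijGroup\<close> are extensional.\<close>

lemma geometric_action_exists:
  "\<exists>\<phi>. group_action G (root_space S) \<phi> \<and>
        (\<forall>s\<in>S. \<forall>v\<in>root_space S. \<phi> s v = (\<lambda>t. v t - form (simple_root s) v * simple_root s t))"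
proof -
  define \<phi> where "\<phi> g = restrict (act (word_of g)) (root_space S)" for g
  have \<phi>: "\<phi> (P u) = restrict (act u) (root_space S)" if "u \<in> lists S" for u
    using that by (simp only: \<phi>_def act_word_of)
  have bij: "bij_betw (act u) (root_space S) (root_space S)" if "u \<in> lists S" for u
    by (rule bij_betw_byWitness[of _ "act (rev u)"]) (use that act_root_space[of u] act_root_space[of "rev u"] in auto)
  have "group_hom G (BijGroup (root_space S)) \<phi>"
  proof (intro group_hom.intro group_hom_axioms.intro is_group group_BijGroup homI)
    show c: "\<phi> x \<in> carrier (BijGroup (root_space S))" if "x \<in> carrier G" for x
      using that bij by (auto simp: carrier_eq BijGroup_def Bij_def \<phi>)
    fix x y assume "x \<in> carrier G" "y \<in> carrier G"
    then obtain u v where uv: "u \<in> lists S" "x = P u" "v \<in> lists S" "y = P v" by (auto simp: carrier_eq)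
    have uv': "\<phi> (P (u @ v)) = restrict (act (u @ v)) (root_space S)"
      by (rule \<phi>) (use uv in auto)
    have "\<phi> (x \<otimes> y) = compose (root_space S) (\<phi> x) (\<phi> y)"
      using uv act_root_space[of v] uv'
      by (simp add: \<phi> P_append restrict_def compose_def fun_eq_iff)
    then show "\<phi> (x \<otimes> y) = \<phi> x \<otimes>\<^bsub>BijGroup (root_space S)\<^esub> \<phi> y"
      using c \<open>x \<in> carrier G\<close> \<open>y \<in> carrier G\<close> by (simp add: BijGroup_def)
  qed
  moreover have "\<phi> s v = (\<lambda>t. v t - form (simple_root s) v * simple_root s t)"
    if "s \<in> S" "v \<in> root_space S" for s v
    using \<phi>[of "[s]"] that S_carrier by (auto simp: reflect_def subset_iff)
  ultimately show ?thesis
    unfolding group_action_def by blast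
qed

text \<open>An action is determined by its values on generators, so whichever action is chosen
  agrees with \<open>act\<close>.\<close>

lemma geometric_action_P:
  assumes "u \<in> lists S" "v \<in> root_space S"
  shows "geometric_action G S m (P u) v = act u v"
proof -
  let ?\<phi> = "geometric_action G S m"
  have \<phi>: "group_action G (root_space S) ?\<phi>"
    "\<And>s v. s \<in> S \<Longrightarrow> v \<in> root_space S \<Longrightarrow> ?\<phi> s v = reflect s v"
    using someI_ex[OF geometric_action_exists] unfolding geometric_action_def reflect_def by blast+
  interpret group_action G "root_space S" ?\<phi> by (fact \<phi>(1))
  show ?thesis
    using assms
  proof (induction u)
    case Nil
    then show ?case using id_eq_one by (metis foldr.simps(1) id_apply restrict_apply word_prod_Nil)
  next
    case (Cons s u)
    then have "?\<phi> (P (s # u)) v = ?\<phi> s (?\<phi> (P u) v)"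
      using S_carrier composition_rule[of v s "P u"] by auto
    then show ?case using Cons \<phi>(2) act_root_space[of u v] by auto
  qed
qed

end

section \<open>Signs of roots\<close>

definition nonneg :: "'w set \<Rightarrow> ('w \<Rightarrow> real) \<Rightarrow> bool" where
  "nonneg S v \<longleftrightarrow> (\<forall>t\<in>S. 0 \<le> v t)"

definition nonpos :: "'w set \<Rightarrow> ('w \<Rightarrow> real) \<Rightarrow> bool" where
  "nonpos S v \<longleftrightarrow> (\<forall>t\<in>S. v t \<le> 0)"

lemma nonneg_minus [simp]: "nonneg S (\<lambda>t. - v t) \<longleftrightarrow> nonpos S v"
  and nonpos_minus [simp]: "nonpos S (\<lambda>t. - v t) \<longleftrightarrow> nonneg S v"
  by (auto simp: nonneg_def nonpos_def)

lemma nonneg_simple_root: "nonneg S (simple_root s)"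
  by (simp add: nonneg_def simple_root_def)

lemma nonneg_lin: "0 \<le> x \<Longrightarrow> 0 \<le> y \<Longrightarrow> nonneg S v \<Longrightarrow> nonneg S w \<Longrightarrow> nonneg S (\<lambda>t. x * v t + y * w t)"
  by (simp add: nonneg_def)

section \<open>The length function and Tits' argument\<close>

context finite_coxeter_system
begin

text \<open>The length of the group element \<open>P u\<close>, not of the word
  \<open>u\<close>.\<close>

definition len :: "'w list \<Rightarrow> nat" where
  "len u = (LEAST n. \<exists>v\<in>lists S. length v = n \<and> P v = P u)"

lemma len_le: "v \<in> lists S \<Longrightarrow> P v = P u \<Longrightarrow> len u \<le> length v"
  unfolding len_def by (rule Least_le) blast

lemma reduced_exists:
  assumes "u \<in> lists S"
  obtains v where "v \<in> lists S" "length v = len u" "P v = P u"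
proof -
  have "\<exists>v\<in>lists S. length v = len u \<and> P v = P u"
    unfolding len_def by (rule LeastI[of _ "length u"]) (use assms in blast)
  then show ?thesis using that by blast
qed

lemma len_cong: "P u = P v \<Longrightarrow> len u = len v"
  by (simp add: len_def)

lemma alternating_lists: "s \<in> S \<Longrightarrow> t \<in> S \<Longrightarrow> alternating s t k \<in> lists S"
  using set_alternating[of s t k] by auto

lemma P_Cons_cancel:
  assumes "s \<in> S" "u \<in> lists S" "v \<in> lists S" "P (s # u) = P v"
  shows "P u = P (s # v)"
proof -
  have "P u = P ([s, s] @ u)" using P_cancel[of s "[]" u] assms by simp
  also have "\<dots> = P ([s] @ v)"
    using P_append_cong[of "[s]" "[s]" "s # u" v] assms by simp
  finally show ?thesis by simp
qed

text \<open>Start from the braid relation for a word of length \<open>2 * k\<close> and move its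
  letters one at a time from the front of the left side to the front of the right side; after
  \<open>k\<close> moves both sides have length \<open>k\<close>.\<close>

lemma P_alternating:
  assumes "s \<in> S" "t \<in> S" "m s t = enat k"
  shows "P (alternating s t k) = P (alternating t s k)"
proof -
  have "P (alternating s t (2 * k - j)) = P (alternating t s j)" if "j \<le> 2 * k" for j
    using that
  proof (induction j)
    case 0
    then show ?case
      using P_braid[of t s k] assms m_sym[of s t] by (simp add: alternating_even)
  next
    case (Suc j)
    have e: "2 * k - j = Suc (2 * k - Suc j)" using Suc.prems by simp
    have "P ((if even j then t else s) # alternating s t (2 * k - Suc j)) = P (alternating s t (2 * k - j))"
      unfolding e alternating_Cons using Suc.prems by auto
    also have "\<dots> = P (alternating t s j)" using Suc by simp
    finally have "P (alternating s t (2 * k - Suc j)) = P ((if even j then t else s) # alternating t s j)"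
      by (rule P_Cons_cancel[rotated 3]) (simp_all add: assms alternating_lists del: in_lists_conv_set)
    then show ?case by (simp only: alternating_Cons)
  qed
  from this[of k] show ?thesis by simp
qed

text \<open>Up to the index \<open>m s t\<close> the sine in \<open>chebyshev_cos\<close> is taken
  at an angle of at most \<pi>; for infinite \<open>m s t\<close> the value is
  \<open>k\<close>.\<close>

lemma chebyshev_nonneg:
  assumes "s \<in> S" "t \<in> S" "s \<noteq> t" "enat k \<le> m s t"
  shows "0 \<le> chebyshev (- b s t) k"
proof (cases "m s t")
  case (enat n)
  have n: "2 \<le> n" using m_ge[of s t] assms enat by (simp add: numeral_eq_enat)
  have "0 < sin (pi / real n)" using n by (intro sin_gt_zero) (auto simp: field_simps)
  moreover have "0 \<le> sin (real k * (pi / real n))"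
    using n assms(4) enat by (intro sin_ge_zero) (auto simp: field_simps)
  ultimately show ?thesis
    unfolding b_enat[OF enat] chebyshev_cos[symmetric] by (simp only: zero_le_mult_iff) auto
next
  case infinity
  then show ?thesis using chebyshev_two[of k] by (simp add: coxeter_coeff_def)
qed

text \<open>Tits' argument: peel off from a reduced word the longest possible alternating tail in \<open>s\<close>
  and another letter; what remains does not get shorter by either of the two letters.\<close>
lemma act_simple_nonneg:
  assumes "u \<in> lists S" "s \<in> S" "len u \<le> len (u @ [s])"
  shows "nonneg S (act u (simple_root s))"
  using assms
proof (induction "len u" arbitrary: u s rule: less_induct)
  case less
  obtain u' where u': "u' \<in> lists S" "length u' = len u" "P u' = P u"
    using reduced_exists less.prems by blast
  show ?case
  proof (cases u' rule: rev_cases)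
    case Nil
    have "act u = act []"
      using act_cong[of u "[]"] u' Nil less.prems by auto
    then show ?thesis by (simp add: nonneg_simple_root)
  next
    case (snoc w t)
    have w: "w \<in> lists S" "t \<in> S" using u' snoc by auto
    \<comment> \<open>As \<open>s\<close> does not shorten \<open>u\<close>, this prevents a reduced
      word for \<open>u\<close> from ending in \<open>s\<close>.\<close>
    have shorter: "len (u @ [s]) \<le> length v" if "v \<in> lists S" "P (v @ [s]) = P u" for v
    proof (rule len_le)
      have "P v = P (v @ [s, s])" using P_cancel[of s v "[]"] that less.prems by simp
      also have "\<dots> = P (u @ [s])"
        using P_append_cong[of "v @ [s]" u "[s]" "[s]"] that less.prems by simp
      finally show "P v = P (u @ [s])" .
    qed fact
    have "t \<noteq> s" using shorter[of w] w u' snoc less.prems by auto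
    define Q where "Q k \<longleftrightarrow> (\<exists>v\<in>lists S. length v + k = len u \<and> P (v @ alternating t s k) = P u)" for k
    have "Q 1" unfolding Q_def using w u' snoc by (intro bexI[of _ w]) auto
    moreover have bound: "k \<le> len u" if "Q k" for k using that by (auto simp: Q_def)
    ultimately obtain k where k: "Q k" "1 \<le> k" "\<And>j. Q j \<Longrightarrow> j \<le> k"
      using Greatest_le_nat[of Q 1 "len u"] GreatestI_nat[of Q 1 "len u"] Greatest_le_nat[of Q _ "len u"] by metis
    then obtain v where v: "v \<in> lists S" "length v + k = len u" "P (v @ alternating t s k) = P u"
      by (auto simp: Q_def)
    have alt: "alternating t s j \<in> lists S" for j
      using alternating_lists w less.prems by blast
    have len_u: "len u \<le> length v' + j" if "v' \<in> lists S" "P (v' @ alternating t s j) = P u" for v' j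
      using len_le[of "v' @ alternating t s j" u] that alt by simp
    have len_v: "len v = length v"
    proof -
      obtain v' where v': "v' \<in> lists S" "length v' = len v" "P v' = P v"
        using reduced_exists v by blast
      have "P (v' @ alternating t s k) = P u"
        using P_append_cong[of v' v "alternating t s k" "alternating t s k"] v' v alt by simp
      then show ?thesis using len_u[of v' k] v' v len_le[of v v] by simp
    qed
    have ext: "len v \<le> len (v @ [r])" if r: "r \<in> {s, t}" for r
    proof (rule ccontr)
      assume "\<not> len v \<le> len (v @ [r])"
      have rS: "r \<in> S" using r w less.prems by auto
      obtain v' where v': "v' \<in> lists S" "length v' = len (v @ [r])" "P v' = P (v @ [r])"
        using reduced_exists[of "v @ [r]"] v rS by auto
      have lt: "length v' < length v" using v' \<open>\<not> len v \<le> len (v @ [r])\<close> len_v by simp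
      \<comment> \<open>A letter \<open>r\<close> that shortens \<open>v\<close> either prolongs the
        tail, against the maximality of \<open>k\<close>, or cancels the first letter of the tail,
        against the length of \<open>u\<close>.\<close>
      consider "alternating t s (Suc k) = r # alternating t s k"
        | "alternating t s k = r # alternating t s (k - 1)"
        using r k(2) alternating_Cons[of t s k] alternating_Cons[of t s "k - 1"] by (cases "even k") auto
      then show False
      proof cases
        case 1
        have "P (v' @ alternating t s (Suc k)) = P ((v @ [r]) @ r # alternating t s k)"
          unfolding 1 by (rule P_append_cong) (use v' v rS alt in auto)
        also have "\<dots> = P u"
          using P_cancel[of r v "alternating t s k"] v rS alt by simp
        finally have *: "P (v' @ alternating t s (Suc k)) = P u" .
        then have "length v' + Suc k = len u"
          using len_u[of v' "Suc k"] lt v v' by linarith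
        then have "Q (Suc k)" using * v' unfolding Q_def by blast
        then show False using k(3)[of "Suc k"] by simp
      next
        case 2
        have "P (v' @ alternating t s (k - 1)) = P ((v @ [r]) @ alternating t s (k - 1))"
          by (rule P_append_cong) (use v' v rS alt in auto)
        also have "\<dots> = P u" using v 2 by simp
        finally show False using len_u[of v' "k - 1"] lt v v' k(2) by simp
      qed
    qed
    have pos: "nonneg S (act v (simple_root r))" if "r \<in> {s, t}" for r
      by (rule less.hyps) (use that v k(2) len_v ext[OF that] w less.prems in auto)
    \<comment> \<open>In a tail of length at least \<open>m s t\<close> the braid relation would
      turn the last letters into a word ending in \<open>s\<close>. The bound makes both
      coefficients in \<open>act_alternating\<close> nonnegative.\<close>
    have small: "enat (Suc k) \<le> m s t"
    proof (rule ccontr)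
      assume "\<not> enat (Suc k) \<le> m s t"
      then obtain n where n: "m s t = enat n" "n \<le> k"
        by (cases "m s t") auto
      have n2: "2 \<le> n" using n m_ge[of s t] \<open>t \<noteq> s\<close> w less.prems by (simp add: numeral_eq_enat)
      obtain p where p: "alternating t s k = p @ alternating t s n" "length p = k - n" "set p \<subseteq> {s, t}"
        using alternating_add[of t s "k - n" n] n(2) by auto
      have pS: "p \<in> lists S" using p(3) w less.prems by auto
      obtain n' where n': "n = Suc n'" using n2 by (cases n) auto
      have "P ((v @ p @ alternating t s n') @ [s]) = P ((v @ p) @ alternating s t n)"
        by (simp add: n')
      also have "\<dots> = P ((v @ p) @ alternating t s n)"
        by (rule P_append_cong)
          (use P_alternating[OF less.prems(2) w(2) n(1), symmetric] v pS alternating_lists w less.prems in \<open>simp_all del: in_lists_conv_set\<close>)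
      also have "\<dots> = P u" using p v by simp
      finally have "len (u @ [s]) \<le> length (v @ p @ alternating t s n')"
        by (rule shorter[rotated]) (use v pS alt in auto)
      then show False using n' n v p less.prems by simp
    qed
    have "act u (simple_root s) = act v (act (alternating t s k) (simple_root s))"
      using act_cong[of u "v @ alternating t s k"] v alt less.prems by simp
    moreover have "0 \<le> chebyshev (- b s t) (Suc k)" "0 \<le> chebyshev (- b s t) k"
      using small \<open>t \<noteq> s\<close> w less.prems
      by (auto intro!: chebyshev_nonneg simp: order.trans[of "enat k" "enat (Suc k)"])
    ultimately show ?thesis
      using act_alternating[of s t k] \<open>t \<noteq> s\<close> w less.prems pos
      by (cases "even k") (auto simp: act_lin intro!: nonneg_lin)
  qed
qed

section \<open>Signs of roots and faithfulness of the action\<close>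

lemma act_snoc_self: "s \<in> S \<Longrightarrow> act (u @ [s]) (simple_root s) = (\<lambda>t. - act u (simple_root s) t)"
  by (simp add: reflect_simple_self act_minus)

text \<open>The word \<open>u @ [s]\<close> is not shortened by \<open>s\<close>, so it sends the
  simple root to a nonnegative vector, and \<open>u\<close> sends it to the negative of that
  vector.\<close>

lemma len_snoc_less:
  assumes "u \<in> lists S" "s \<in> S" "len (u @ [s]) < len u"
  shows "nonpos S (act u (simple_root s))"
proof -
  have "P (u @ [s, s]) = P u" using P_cancel[of s u "[]"] assms by simp
  then have "len (u @ [s]) \<le> len ((u @ [s]) @ [s])"
    using assms len_cong by (metis append.assoc append_Cons append_Nil less_imp_le)
  then have "nonneg S (act (u @ [s]) (simple_root s))"
    using act_simple_nonneg[of "u @ [s]" s] assms by auto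
  then show ?thesis
    using assms(2) by (simp only: act_snoc_self nonneg_minus)
qed

text \<open>The roots in terms of words; \<open>roots_eq\<close> identifies them with
  \<open>roots G S m\<close>.\<close>

definition root_set :: "('w \<Rightarrow> real) set" where
  "root_set = {act u (simple_root s) | u s. u \<in> lists S \<and> s \<in> S}"

lemma simple_root_in [simp]: "s \<in> S \<Longrightarrow> simple_root s \<in> root_set"
  unfolding root_set_def by (intro CollectI exI[of _ "[]"]) auto

lemma act_in_root_set: "u \<in> lists S \<Longrightarrow> z \<in> root_set \<Longrightarrow> act u z \<in> root_set"
proof -
  assume u: "u \<in> lists S" and "z \<in> root_set"
  then obtain v s where "z = act v (simple_root s)" "v \<in> lists S" "s \<in> S" by (auto simp: root_set_def)
  then show ?thesis unfolding root_set_def using u by (intro CollectI exI[of _ "u @ v"] exI[of _ s]) auto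
qed

lemma reflect_in_root_set: "s \<in> S \<Longrightarrow> z \<in> root_set \<Longrightarrow> reflect s z \<in> root_set"
  using act_in_root_set[of "[s]" z] by simp

lemma minus_in_root_set: "z \<in> root_set \<Longrightarrow> (\<lambda>t. - z t) \<in> root_set"
proof -
  assume "z \<in> root_set"
  then obtain u s where u: "z = act u (simple_root s)" "u \<in> lists S" "s \<in> S" by (auto simp: root_set_def)
  then have "(\<lambda>t. - z t) = act (u @ [s]) (simple_root s)" by (simp only: act_snoc_self)
  then show ?thesis unfolding root_set_def using u by (intro CollectI exI[of _ "u @ [s]"] exI[of _ s]) auto
qed

lemma root_nonneg_or_nonpos: "z \<in> root_set \<Longrightarrow> nonneg S z \<or> nonpos S z"
  unfolding root_set_def using act_simple_nonneg len_snoc_less not_le by blast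

lemma root_root_space: "z \<in> root_set \<Longrightarrow> z \<in> root_space S"
  unfolding root_set_def using act_root_space simple_root_space by auto

lemma form_root: "z \<in> root_set \<Longrightarrow> form z z = 2"
  unfolding root_set_def by (auto simp: form_act)

text \<open>A root has norm 2 and therefore does not vanish.\<close>

lemma root_not_both: assumes "z \<in> root_set" "nonneg S z" shows "\<not> nonpos S z"
proof
  assume "nonpos S z"
  then have "\<And>s. s \<in> S \<Longrightarrow> z s = 0" using assms(2) by (force simp: nonneg_def nonpos_def)
  then have "form z z = 0" by (simp add: coxeter_form_def)
  then show False using form_root[OF assms(1)] by simp
qed

text \<open>Only the coordinate at \<open>s\<close> changes. If the sign changed, \<open>z\<close>
  would be a nonnegative multiple of the simple root, and norm 2 forces the factor 1.\<close>

lemma reflect_nonneg: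
  assumes "s \<in> S" "z \<in> root_set" "nonneg S z" "z \<noteq> simple_root s"
  shows "nonneg S (reflect s z)"
proof (rule ccontr)
  assume "\<not> nonneg S (reflect s z)"
  then have neg: "nonpos S (reflect s z)"
    using root_nonneg_or_nonpos reflect_in_root_set assms by blast
  have 0: "z t = 0" if "t \<noteq> s" for t
  proof (cases "t \<in> S")
    case True
    then show ?thesis
      using neg assms(3) that by (force simp: nonneg_def nonpos_def reflect_def simple_root_def)
  next
    case False
    then show ?thesis using root_root_space[OF assms(2)] by (simp add: root_space_def)
  qed
  then have z: "z = (\<lambda>t. z s * simple_root s t + 0 * simple_root s t)"
    by (auto simp: simple_root_def)
  have "form z z = z s * form z (simple_root s)"
    using form_lin_right[of z "z s" "simple_root s" 0 "simple_root s"] z by simp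
  also have "form z (simple_root s) = z s * 2"
    using assms(1) form_lin_right[of "simple_root s" "z s" "simple_root s" 0 "simple_root s"] z
      form_sym[of z "simple_root s"] by simp
  finally have "z s * z s = 1" using form_root[OF assms(2)] by simp
  moreover have "0 \<le> z s" using assms by (simp add: nonneg_def)
  ultimately have "z s = 1" by (metis abs_of_nonneg abs_1 abs_mult_self_eq mult.right_neutral power2_eq_square real_sqrt_abs2 real_sqrt_one)
  then show False using assms(4) z by auto
qed

text \<open>The action is faithful: the simple root of the last letter of a nonempty reduced word is
  made negative. Hence the group embeds into the maps from \<open>S\<close> to the roots.\<close>

lemma finite_carrier_iff: "finite (carrier G) \<longleftrightarrow> finite root_set"
proof
  assume fin: "finite (carrier G)"
  define h where "h p = act (word_of (fst p)) (simple_root (snd p))" for p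
  have "root_set \<subseteq> h ` (carrier G \<times> S)"
  proof
    fix z assume "z \<in> root_set"
    then obtain u s where u: "z = act u (simple_root s)" "u \<in> lists S" "s \<in> S" by (auto simp: root_set_def)
    then have "z = h (P u, s)" by (simp only: h_def fst_conv snd_conv act_word_of)
    then show "z \<in> h ` (carrier G \<times> S)" using u by (intro image_eqI[of _ _ "(P u, s)"]) auto
  qed
  then show "finite root_set" using fin finite_S finite_subset by blast
next
  assume fin: "finite root_set"
  define h where "h g = restrict (\<lambda>s. act (word_of g) (simple_root s)) S" for g
  have h: "h (P u) = restrict (\<lambda>s. act u (simple_root s)) S" if "u \<in> lists S" for u
    using that by (simp only: h_def act_word_of)
  have faithful: "P w = \<one>" if w: "w \<in> lists S" and fix_w: "\<And>s. s \<in> S \<Longrightarrow> act w (simple_root s) = simple_root s" for w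
  proof -
    obtain w' where w': "w' \<in> lists S" "length w' = len w" "P w' = P w"
      using reduced_exists w by blast
    show ?thesis
    proof (cases w' rule: rev_cases)
      case Nil
      then show ?thesis using w' by simp
    next
      case (snoc x s)
      then have xs: "x \<in> lists S" "s \<in> S" using w' by auto
      have "P x = P (x @ [s, s])" using P_cancel[of s x "[]"] xs by simp
      also have "\<dots> = P (w @ [s])"
        using P_append_cong[of "x @ [s]" w "[s]" "[s]"] xs w' w snoc by simp
      finally have "len (w @ [s]) \<le> length x" using xs by (intro len_le)
      then have "nonpos S (act w (simple_root s))"
        using len_snoc_less[of w s] w xs w' snoc by simp
      then show ?thesis
        using fix_w xs root_not_both[of "simple_root s"] nonneg_simple_root[of S s] by simp
    qed
  qed
  have "inj_on h (carrier G)"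
  proof (rule inj_onI)
    fix x y assume "x \<in> carrier G" "y \<in> carrier G" and eq: "h x = h y"
    then obtain u v where uv: "u \<in> lists S" "x = P u" "v \<in> lists S" "y = P v" by (auto simp: carrier_eq)
    have "act u (simple_root s) = act v (simple_root s)" if "s \<in> S" for s
      using fun_cong[OF eq, of s] h uv that by simp
    then have "P (rev v @ u) = \<one>"
      using uv by (intro faithful) auto
    then have "P (rev v) \<otimes> P u = P (rev v) \<otimes> P v"
      using uv P_append[of "rev v" u] P_rev[of "rev v"] by simp
    then show "x = y"
      using uv Units_l_cancel[of "P (rev v)" "P u" "P v"] by (simp add: Units_eq)
  qed
  moreover have "h ` carrier G \<subseteq> S \<rightarrow>\<^sub>E root_set"
    using h act_in_root_set by (auto simp: carrier_eq PiE_iff)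
  ultimately show "finite (carrier G)"
    using inj_on_finite finite_PiE finite_S fin by metis
qed

end

section \<open>Orientations and the Euler form\<close>

lemma sink_sequence_append:
  "sink_sequence V D (xs @ ys) \<longleftrightarrow> sink_sequence V D xs \<and> sink_sequence V (fold reverse_at xs D) ys"
  by (induction xs arbitrary: D) auto

lemma sink_sequence_lists: "sink_sequence V D xs \<Longrightarrow> xs \<in> lists V"
  by (induction xs arbitrary: D) (auto simp: is_sink_def)

section \<open>Acyclic orientations of the Coxeter graph\<close>

context finite_coxeter_system
begin

text \<open>The Coxeter graph on \<open>S\<close> itself, labelled by the identity; the vertex set
  \<open>V0\<close> enters in the last section.\<close>

abbreviation "edges \<equiv> coxeter_edges m S (\<lambda>s. s)"

lemma b_edge: "(s, t) \<in> edges \<Longrightarrow> b s t < 0"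
  by (auto simp: coxeter_edges_def b_neg)

lemma edgesD: "(s, t) \<in> edges \<Longrightarrow> s \<in> S \<and> t \<in> S \<and> s \<noteq> t"
  by (auto simp: coxeter_edges_def)

lemma edges_sym: "(s, t) \<in> edges \<Longrightarrow> (t, s) \<in> edges"
  by (auto simp: coxeter_edges_def m_sym)

lemma b_nonedge: "s \<in> S \<Longrightarrow> t \<in> S \<Longrightarrow> s \<noteq> t \<Longrightarrow> (s, t) \<notin> edges \<Longrightarrow> b s t = 0"
  using m_ge[of s t] by (intro b_commuting) (auto simp: coxeter_edges_def)

text \<open>Acyclicity is given by a height \<open>f\<close> that drops along every arrow, ready for
  use as an induction measure.\<close>

definition acyclic_orientation :: "('w \<times> 'w) set \<Rightarrow> bool" where
  "acyclic_orientation D \<longleftrightarrow> D \<subseteq> edges \<and> (\<forall>(s, t) \<in> edges. (s, t) \<in> D \<longleftrightarrow> (t, s) \<notin> D) \<and>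
     (\<exists>f :: 'w \<Rightarrow> nat. \<forall>(s, t) \<in> D. f t < f s)"

lemma acyclic_orientation_edges: "acyclic_orientation D \<Longrightarrow> (s, t) \<in> D \<Longrightarrow> (s, t) \<in> edges"
  and acyclic_orientation_asym: "acyclic_orientation D \<Longrightarrow> (s, t) \<in> edges \<Longrightarrow> (s, t) \<in> D \<longleftrightarrow> (t, s) \<notin> D"
  by (auto simp: acyclic_orientation_def)

lemma acyclic_orientation_reverse:
  assumes D: "acyclic_orientation D" and x: "is_sink S D x"
  shows "acyclic_orientation (reverse_at x D)"
proof -
  obtain f :: "'w \<Rightarrow> nat" where f: "\<And>s t. (s, t) \<in> D \<Longrightarrow> f t < f s"
    using D unfolding acyclic_orientation_def by blast
  \<comment> \<open>The sink becomes a source, so it is lifted above all other heights.\<close>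
  define g where "g = f(x := Suc (Max (f ` S)))"
  have "g t < g s" if "(s, t) \<in> reverse_at x D" for s t
  proof (cases "s = x")
    case True
    then have "(t, x) \<in> D" using that by (simp add: reverse_at_def)
    then have "t \<in> S" "t \<noteq> x" using acyclic_orientation_edges[OF D] edgesD by blast+
    then show ?thesis using True finite_S by (simp add: g_def less_Suc_eq_le)
  next
    case False
    then have "t \<noteq> x" "(s, t) \<in> D"
      using that x by (auto simp: reverse_at_def is_sink_def split: if_splits)
    then show ?thesis using False f by (simp add: g_def)
  qed
  moreover have "reverse_at x D \<subseteq> edges"
    using acyclic_orientation_edges[OF D] edges_sym by (auto simp: reverse_at_def split: if_splits)
  moreover have "(s, t) \<in> reverse_at x D \<longleftrightarrow> (t, s) \<notin> reverse_at x D" if "(s, t) \<in> edges" for s t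
    using acyclic_orientation_asym[OF D that] by (auto simp: reverse_at_def)
  ultimately show ?thesis unfolding acyclic_orientation_def by blast
qed

abbreviation final :: "('w \<times> 'w) set \<Rightarrow> 'w list \<Rightarrow> ('w \<times> 'w) set" where
  "final D xs \<equiv> fold reverse_at xs D"

lemma acyclic_orientation_final:
  "acyclic_orientation D \<Longrightarrow> sink_sequence S D xs \<Longrightarrow> acyclic_orientation (final D xs)"
  by (induction xs arbitrary: D) (auto simp: acyclic_orientation_reverse)

section \<open>The Euler form of an orientation\<close>

definition euler_coeff :: "('w \<times> 'w) set \<Rightarrow> 'w \<Rightarrow> 'w \<Rightarrow> real" where
  "euler_coeff D s t = (if s = t then 1 else if (s, t) \<in> D then b s t else 0)"

text \<open>A nonsymmetric half of the Coxeter form: each edge contributes its coefficient only in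
  the direction of its arrow. Adding the transpose gives the Coxeter form back, see
  \<open>euler_form_add_swap\<close>.\<close>

definition euler_form :: "('w \<times> 'w) set \<Rightarrow> ('w \<Rightarrow> real) \<Rightarrow> ('w \<Rightarrow> real) \<Rightarrow> real" where
  "euler_form D x y = (\<Sum>s\<in>S. \<Sum>t\<in>S. x s * y t * euler_coeff D s t)"

lemma euler_form_diff_left: "euler_form D (\<lambda>t. x t - a * z t) y = euler_form D x y - a * euler_form D z y"
  unfolding euler_form_def sum_distrib_left sum_subtractf[symmetric]
  by (intro sum.cong HOL.refl) (simp add: algebra_simps)

lemma euler_form_diff_right: "euler_form D x (\<lambda>t. y t - a * z t) = euler_form D x y - a * euler_form D x z"
  unfolding euler_form_def sum_distrib_left sum_subtractf[symmetric]
  by (intro sum.cong HOL.refl) (simp add: algebra_simps)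

lemma euler_form_minus_right: "euler_form D x (\<lambda>t. - y t) = - euler_form D x y"
  by (simp add: euler_form_def sum_negf)

lemma sum_simple_root: "s \<in> S \<Longrightarrow> (\<Sum>t\<in>S. simple_root s t * f t) = f s"
  by (simp add: simple_root_def finite_S if_distrib if_distribR sum.delta cong: if_cong)

lemma euler_form_simple_left:
  assumes "s \<in> S"
  shows "euler_form D (simple_root s) y = (\<Sum>t\<in>S. y t * euler_coeff D s t)"
proof -
  have "euler_form D (simple_root s) y = (\<Sum>u\<in>S. simple_root s u * (\<Sum>t\<in>S. y t * euler_coeff D u t))"
    by (simp add: euler_form_def sum_distrib_left mult.assoc)
  then show ?thesis using assms by (simp add: sum_simple_root)
qed

lemma euler_form_simple_right:
  assumes "s \<in> S"
  shows "euler_form D y (simple_root s) = (\<Sum>t\<in>S. y t * euler_coeff D t s)"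
proof -
  have "euler_form D y (simple_root s) = (\<Sum>u\<in>S. \<Sum>t\<in>S. simple_root s t * (y u * euler_coeff D u t))"
    by (simp add: euler_form_def mult_ac)
  then show ?thesis using assms by (simp add: sum_simple_root)
qed

lemma euler_form_simple:
  "s \<in> S \<Longrightarrow> t \<in> S \<Longrightarrow> euler_form D (simple_root s) (simple_root t) = euler_coeff D s t"
  by (simp add: euler_form_simple_left sum_simple_root)

text \<open>No arrow starts at a sink, so its row of coefficients is a unit vector. For the column
  of a source the same holds below.\<close>

lemma euler_form_sink_left:
  assumes "is_sink S D s"
  shows "euler_form D (simple_root s) y = y s"
proof -
  have "s \<in> S" "\<And>t. euler_coeff D s t = simple_root s t"
    using assms by (auto simp: is_sink_def euler_coeff_def simple_root_def)
  then show ?thesis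
    by (simp add: euler_form_simple_left mult.commute[of "y _"] sum_simple_root)
qed

lemma euler_form_source_right:
  assumes "s \<in> S" "\<And>t. (t, s) \<notin> D"
  shows "euler_form D y (simple_root s) = y s"
proof -
  have "\<And>t. euler_coeff D t s = simple_root s t"
    using assms by (auto simp: euler_coeff_def simple_root_def)
  then show ?thesis
    using assms(1) by (simp add: euler_form_simple_right mult.commute[of "y _"] sum_simple_root)
qed

lemma euler_form_add_swap:
  assumes "acyclic_orientation D" "s \<in> S"
  shows "euler_form D (simple_root s) y + euler_form D y (simple_root s) = form (simple_root s) y"
proof -
  have coeff: "euler_coeff D t s = b s t - euler_coeff D s t" if t: "t \<in> S" for t
  proof (cases "(s, t) \<in> edges")
    case True
    then show ?thesis
      using acyclic_orientation_asym[OF assms(1) True] edgesD[OF True] b_sym[OF assms(2) t]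
      by (auto simp: euler_coeff_def)
  next
    case False
    then have "(s, t) \<notin> D" "(t, s) \<notin> D"
      using acyclic_orientation_edges[OF assms(1)] edges_sym by blast+
    then show ?thesis
      using b_nonedge[OF assms(2) t _ False] assms(2) by (auto simp: euler_coeff_def)
  qed
  show ?thesis
    unfolding euler_form_simple_left[OF assms(2)] euler_form_simple_right[OF assms(2)]
      form_simple_left[OF assms(2)] sum.distrib[symmetric]
    by (intro sum.cong HOL.refl) (simp add: coeff algebra_simps)
qed

text \<open>The Coxeter form minus the coordinate from \<open>euler_form_sink_left\<close> is minus
  the coordinate at \<open>s\<close> after reflection.\<close>

lemma euler_form_sink_right:
  assumes "acyclic_orientation D" "is_sink S D s"
  shows "euler_form D y (simple_root s) = - reflect s y s"
  using euler_form_add_swap[OF assms(1), of s y] euler_form_sink_left[OF assms(2), of y] assms(2)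
  by (simp add: is_sink_def reflect_def simple_root_def)

text \<open>Reversing at the sink moves the edge coefficients from column \<open>s\<close> to row
  \<open>s\<close>; on the diagonal the two corrections cancel.\<close>

lemma euler_form_reverse:
  assumes D: "acyclic_orientation D" and s: "is_sink S D s"
  shows "euler_form (reverse_at s D) x y =
    euler_form D x y + x s * form (simple_root s) y - y s * form (simple_root s) x"
proof -
  let ?D = "reverse_at s D"
  have sS: "s \<in> S" using s by (simp add: is_sink_def)
  have coeff: "euler_coeff ?D u t = euler_coeff D u t + simple_root s u * b s t - simple_root s t * b s u"
    if "u \<in> S" "t \<in> S" for u t
  proof -
    have "(s, v) \<notin> D" for v using s by (simp add: is_sink_def)
    moreover have "b s v = 0" if "v \<in> S" "v \<noteq> s" "(v, s) \<notin> D" for v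
      using that sS b_nonedge[of s v] acyclic_orientation_asym[OF D, of s v] \<open>(s, v) \<notin> D\<close> by blast
    ultimately show ?thesis
      using that sS b_sym[of s u] by (auto simp: euler_coeff_def reverse_at_def simple_root_def)
  qed
  have "euler_form ?D x y = (\<Sum>u\<in>S. \<Sum>t\<in>S. x u * y t * euler_coeff D u t
      + simple_root s u * (x u * (b s t * y t)) - simple_root s t * (y t * (b s u * x u)))"
    unfolding euler_form_def by (intro sum.cong HOL.refl) (simp add: coeff algebra_simps)
  also have "\<dots> = euler_form D x y + (\<Sum>u\<in>S. simple_root s u * (x u * (\<Sum>t\<in>S. b s t * y t)))
      - (\<Sum>u\<in>S. \<Sum>t\<in>S. simple_root s t * (y t * (b s u * x u)))"
    by (simp add: euler_form_def sum.distrib sum_subtractf sum_distrib_left)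
  also have "\<dots> = euler_form D x y + x s * form (simple_root s) y - y s * form (simple_root s) x"
    using sS by (simp add: sum_simple_root form_simple_left flip: sum_distrib_left)
  finally show ?thesis .
qed

text \<open>In the reversed orientation \<open>s\<close> is a source, so both pairings with its
  simple root are explicit. The terms they contribute cancel the correction of
  \<open>euler_form_reverse\<close>.\<close>

lemma euler_form_reflect:
  assumes D: "acyclic_orientation D" and s: "is_sink S D s"
  shows "euler_form (reverse_at s D) (reflect s x) (reflect s y) = euler_form D x y"
proof -
  let ?D = "reverse_at s D"
  have sS: "s \<in> S" using s by (simp add: is_sink_def)
  have "(t, s) \<notin> ?D" for t using s by (auto simp: is_sink_def reverse_at_def)
  then have right: "euler_form ?D z (simple_root s) = z s" for z
    using euler_form_source_right sS by blast
  have left: "euler_form ?D (simple_root s) z = form (simple_root s) z - z s" for z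
    using euler_form_add_swap[OF acyclic_orientation_reverse[OF D s] sS, of z] right by simp
  have "euler_form ?D (reflect s x) (reflect s y) = euler_form ?D x y
      - form (simple_root s) y * x s + y s * form (simple_root s) x"
    unfolding reflect_def euler_form_diff_left euler_form_diff_right right left
    using sS by (simp add: algebra_simps) (simp add: simple_root_def)
  then show ?thesis unfolding euler_form_reverse[OF D s] by simp
qed

lemma euler_form_act:
  assumes "acyclic_orientation D" "sink_sequence S D xs"
  shows "euler_form D (act xs x) (act xs y) = euler_form (final D xs) x y"
  using assms
proof (induction xs arbitrary: D)
  case (Cons s xs)
  then have "euler_form D (act (s # xs) x) (act (s # xs) y) = euler_form (reverse_at s D) (act xs x) (act xs y)"
    using euler_form_reflect[of D s "act (s # xs) x" "act (s # xs) y"] by (simp add: is_sink_def)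
  then show ?case using Cons by (simp add: acyclic_orientation_reverse)
qed simp

text \<open>Undoing \<open>ys\<close> leads to the orientation in which \<open>x\<close> is a sink.
  Pairing with an inversion thus reads off a coordinate of \<open>z\<close> just after
  \<open>x\<close> has been processed.\<close>

lemma euler_form_root:
  assumes D: "acyclic_orientation D" and xs: "sink_sequence S D (ys @ [x])"
  shows "euler_form D z (act ys (simple_root x)) = - act (rev (ys @ [x])) z x"
proof -
  have ys: "sink_sequence S D ys" "ys \<in> lists S" "is_sink S (final D ys) x"
    using xs sink_sequence_lists by (auto simp: sink_sequence_append)
  have "euler_form D z (act ys (simple_root x)) = euler_form D (act ys (act (rev ys) z)) (act ys (simple_root x))"
    using ys by simp
  also have "\<dots> = - reflect x (act (rev ys) z) x"
    using euler_form_act[OF D ys(1)] euler_form_sink_right[OF acyclic_orientation_final[OF D ys(1)] ys(3)] by simp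
  finally show ?thesis by simp
qed

text \<open>For words over \<open>S\<close> this is reducedness, expressed by the signs of the
  inversions instead of by length.\<close>

definition positive_word :: "'w list \<Rightarrow> bool" where
  "positive_word xs \<longleftrightarrow> (\<forall>ys x zs. xs = ys @ x # zs \<longrightarrow> nonneg S (act ys (simple_root x)))"

lemma positive_word_Nil [simp]: "positive_word []"
  by (simp add: positive_word_def)

lemma positive_word_prefix: "positive_word (xs @ ys) \<Longrightarrow> positive_word xs"
  by (auto simp: positive_word_def)

lemma positive_word_snoc [simp]:
  "positive_word (xs @ [x]) \<longleftrightarrow> positive_word xs \<and> nonneg S (act xs (simple_root x))"
proof
  assume "positive_word (xs @ [x])"
  then show "positive_word xs \<and> nonneg S (act xs (simple_root x))"
    using positive_word_prefix unfolding positive_word_def by blast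
next
  assume *: "positive_word xs \<and> nonneg S (act xs (simple_root x))"
  show "positive_word (xs @ [x])"
    unfolding positive_word_def
  proof (intro allI impI)
    fix ys y zs assume eq: "xs @ [x] = ys @ y # zs"
    show "nonneg S (act ys (simple_root y))"
    proof (cases zs rule: rev_cases)
      case Nil
      then show ?thesis using eq * by simp
    next
      case (snoc zs' z)
      then have "xs = ys @ y # zs'" using eq by simp
      then show ?thesis using * by (simp add: positive_word_def)
    qed
  qed
qed

text \<open>The sign can return at a letter \<open>x\<close> only if the current vector is minus the
  simple root of \<open>x\<close>; then the inversion belonging to \<open>x\<close> would be minus
  \<open>z\<close>, against positivity of the word.\<close>

lemma inverted_stays_inverted:
  assumes "positive_word (ys @ zs)" "ys @ zs \<in> lists S" "z \<in> root_set" "nonneg S z" "nonpos S (act (rev ys) z)"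
  shows "nonpos S (act (rev (ys @ zs)) z)"
  using assms(1,2)
proof (induction zs rule: rev_induct)
  case Nil
  then show ?case using assms by simp
next
  case (snoc x zs)
  let ?u = "ys @ zs"
  define g where "g = act (rev ?u) z"
  have u: "?u \<in> lists S" "x \<in> S" "positive_word ?u" "nonneg S (act ?u (simple_root x))"
    using snoc.prems positive_word_snoc[of ?u x] by auto
  have g: "nonpos S g" "g \<in> root_set"
    using snoc.IH u act_in_root_set[of "rev ?u" z] assms by (simp_all add: g_def)
  have "(\<lambda>t. - g t) \<noteq> simple_root x"
  proof
    assume eq: "(\<lambda>t. - g t) = simple_root x"
    have "act ?u (\<lambda>t. - g t) = (\<lambda>t. - z t)"
      unfolding act_minus g_def using u by (simp only: act_rev)
    then have "nonpos S z" using u eq nonneg_minus[of S z] by simp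
    then show False using assms root_not_both by blast
  qed
  then have "nonneg S (reflect x (\<lambda>t. - g t))"
    using g u minus_in_root_set by (intro reflect_nonneg) auto
  then show ?case by (simp add: reflect_minus g_def)
qed

text \<open>When the sign changes from positive to negative, the current root is the simple root of
  the letter being processed. Undoing the prefix recovers \<open>z\<close>.\<close>

lemma inverted_root:
  assumes "xs \<in> lists S" "z \<in> root_set" "nonneg S z" "nonpos S (act (rev xs) z)"
  obtains ys x zs where "xs = ys @ x # zs" "z = act ys (simple_root x)"
proof -
  have "\<exists>ys x zs. xs = ys @ x # zs \<and> z = act ys (simple_root x)"
    using assms
  proof (induction xs rule: rev_induct)
    case Nil
    then show ?case using root_not_both by simp
  next
    case (snoc x xs)
    define g where "g = act (rev xs) z"
    have g: "g \<in> root_set" "nonpos S (reflect x g)" "x \<in> S" "xs \<in> lists S"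
      using snoc.prems act_in_root_set[of "rev xs" z] by (simp_all add: g_def)
    show ?case
    proof (cases "nonpos S g")
      case True
      then obtain ys y zs where "xs = ys @ y # zs" "z = act ys (simple_root y)"
        using snoc g g_def by auto
      then show ?thesis by (intro exI[of _ ys] exI[of _ y] exI[of _ "zs @ [x]"]) simp
    next
      case False
      then have "nonneg S g" using root_nonneg_or_nonpos g by blast
      then have "g = simple_root x"
        using reflect_nonneg[of x g] g root_not_both[of "reflect x g"] reflect_in_root_set by blast
      then have "z = act xs (simple_root x)" using g by (metis act_rev g_def)
      then show ?thesis by blast
    qed
  qed
  then show ?thesis using that by blast
qed

end

section \<open>Admissible words\<close>

context finite_coxeter_system
begin

text \<open>The positive root \<open>y\<close> is an inversion of the word. If \<open>z\<close> were
  positive, its Euler pairing with \<open>y\<close> would make \<open>z\<close> negative once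
  \<open>y\<close> has been inverted. Then \<open>z\<close> stays negative, although it ends as a
  simple root.\<close>

lemma inverted_orientation_step:
  assumes D: "acyclic_orientation D" and xs: "sink_sequence S D xs" "positive_word xs"
    and vu: "(v, u) \<in> final D xs" and u: "nonpos S (act xs (simple_root u))"
  shows "nonpos S (act xs (simple_root v))"
proof (rule ccontr)
  define z where "z = act xs (simple_root v)"
  define y where "y = (\<lambda>t. - act xs (simple_root u) t)"
  have D': "acyclic_orientation (final D xs)" using acyclic_orientation_final D xs by blast
  have S: "v \<in> S" "u \<in> S" "v \<noteq> u" "(v, u) \<in> edges"
    using acyclic_orientation_edges[OF D' vu] edgesD by blast+
  have l: "xs \<in> lists S" using xs sink_sequence_lists by blast
  have z: "z \<in> root_set" "act (rev xs) z = simple_root v"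
    using S l act_in_root_set by (simp_all add: z_def)
  have y: "y \<in> root_set" "nonneg S y" "nonpos S (act (rev xs) y)"
    using S l act_in_root_set minus_in_root_set u by (simp_all add: y_def act_minus nonneg_simple_root)
  assume "\<not> nonpos S (act xs (simple_root v))"
  then have "nonneg S z" using z root_nonneg_or_nonpos z_def by blast
  obtain ys x zs where xs_eq: "xs = ys @ x # zs" and y_eq: "y = act ys (simple_root x)"
    using inverted_root l y by blast
  have ys: "sink_sequence S D (ys @ [x])" "(ys @ [x]) @ zs = xs" "ys @ [x] \<in> lists S" "x \<in> S"
    using xs(1) l xs_eq by (auto simp: sink_sequence_append)
  \<comment> \<open>The pairing is evaluated twice: at the end of the word, where it is the
    coefficient of the arrow, and at the letter \<open>x\<close> inverting \<open>y\<close>, where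
    it is a coordinate.\<close>
  have "b v u = euler_form D z (act xs (simple_root u))"
    using euler_form_act[OF D xs(1)] S vu by (simp add: z_def euler_form_simple euler_coeff_def)
  also have "\<dots> = - euler_form D z y"
    by (simp add: y_def euler_form_minus_right)
  also have "\<dots> = act (rev (ys @ [x])) z x"
    unfolding y_eq euler_form_root[OF D ys(1)] by simp
  finally have "act (rev (ys @ [x])) z x < 0" using b_edge[OF S(4)] by linarith
  then have "\<not> nonneg S (act (rev (ys @ [x])) z)"
    using ys by (auto simp: nonneg_def not_le intro!: bexI[of _ x])
  moreover have "act (rev (ys @ [x])) z \<in> root_set"
    by (rule act_in_root_set) (use ys z in auto)
  ultimately have "nonpos S (act (rev (ys @ [x])) z)" using root_nonneg_or_nonpos by blast
  then have "nonpos S (act (rev xs) z)"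
    using inverted_stays_inverted[of "ys @ [x]" zs z, unfolded ys(2)] xs l z \<open>nonneg S z\<close> by blast
  then show False using z S root_not_both[of "simple_root v"] nonneg_simple_root[of S v] by simp
qed

text \<open>Induction on the height: a vertex that is not a sink has an arrow to a lower
  vertex.\<close>

lemma acyclic_orientation_induct:
  assumes D: "acyclic_orientation D" and "v \<in> S"
    and sink: "\<And>x. is_sink S D x \<Longrightarrow> Q x" and step: "\<And>v u. (v, u) \<in> D \<Longrightarrow> Q u \<Longrightarrow> Q v"
  shows "Q v"
proof -
  obtain f :: "'w \<Rightarrow> nat" where f: "\<And>s t. (s, t) \<in> D \<Longrightarrow> f t < f s"
    using D unfolding acyclic_orientation_def by blast
  show ?thesis
    using \<open>v \<in> S\<close>
  proof (induction "f v" arbitrary: v rule: less_induct)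
    case less
    show ?case
    proof (cases "is_sink S D v")
      case False
      then obtain u where "(v, u) \<in> D" using less.prems by (auto simp: is_sink_def)
      then show ?thesis
        using less.hyps f step acyclic_orientation_edges[OF D] edgesD by metis
    qed (rule sink)
  qed
qed

text \<open>The induction principle with a predicate that ignores its argument.\<close>

lemma sink_exists:
  assumes "acyclic_orientation D" "S \<noteq> {}"
  obtains x where "is_sink S D x"
  using acyclic_orientation_induct[OF assms(1), of _ "\<lambda>_. \<exists>x. is_sink S D x"] assms(2) by blast

lemma source_exists:
  assumes D: "acyclic_orientation D" and "S \<noteq> {}"
  obtains x where "x \<in> S" "\<And>t. (t, x) \<notin> D"
proof -
  obtain f :: "'w \<Rightarrow> nat" where f: "\<And>s t. (s, t) \<in> D \<Longrightarrow> f t < f s"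
    using D unfolding acyclic_orientation_def by blast
  have "Max (f ` S) \<in> f ` S" using assms finite_S by (intro Max_in) auto
  then obtain x where x: "x \<in> S" "f x = Max (f ` S)" by auto
  have "(t, x) \<notin> D" for t
  proof
    assume t: "(t, x) \<in> D"
    then have "t \<in> S" using acyclic_orientation_edges[OF D] edgesD by blast
    then have "f t \<le> f x" using x finite_S by simp
    then show False using f t by fastforce
  qed
  then show ?thesis using that x by blast
qed

section \<open>Words that invert every letter\<close>

lemma act_sum:
  "finite A \<Longrightarrow> act u (\<lambda>t. \<Sum>s\<in>A. c s * v s t) = (\<lambda>t. \<Sum>s\<in>A. c s * act u (v s) t)"
proof (induction A rule: finite_induct)
  case empty
  show ?case using act_lin[of u 0 "\<lambda>_. 0" 0 "\<lambda>_. 0"] by simp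
next
  case (insert s A)
  then show ?case
    using act_lin[of u "c s" "v s" 1 "\<lambda>t. \<Sum>s\<in>A. c s * v s t"] by simp
qed

lemma act_expand:
  assumes "v \<in> root_space S"
  shows "act u v = (\<lambda>t. \<Sum>s\<in>S. v s * act u (simple_root s) t)"
proof -
  have "v = (\<lambda>t. \<Sum>s\<in>S. v s * simple_root s t)"
    using assms by (auto simp: root_space_def simple_root_def fun_eq_iff finite_S if_distrib sum.delta cong: if_cong)
  then show ?thesis using act_sum[OF finite_S, of u v simple_root] by simp
qed

text \<open>If \<open>g\<close> were nonnegative, \<open>z\<close> would be a nonnegative
  combination of the nonpositive images of the simple roots.\<close>

lemma longest_inverts_all:
  assumes xs: "xs \<in> lists S" and neg: "\<And>v. v \<in> S \<Longrightarrow> nonpos S (act xs (simple_root v))"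
    and z: "z \<in> root_set" "nonneg S z"
  shows "nonpos S (act (rev xs) z)"
proof (rule ccontr)
  define g where "g = act (rev xs) z"
  have g: "g \<in> root_set" using xs z act_in_root_set by (simp add: g_def)
  assume "\<not> nonpos S (act (rev xs) z)"
  then have "nonneg S g" using root_nonneg_or_nonpos g g_def by blast
  then have "nonpos S (act xs g)"
    using neg unfolding act_expand[OF root_root_space[OF g]] nonneg_def nonpos_def
    by (auto intro!: sum_nonpos mult_nonneg_nonpos)
  then show False using xs z root_not_both by (simp add: g_def)
qed

text \<open>Every positive root is an inversion of the one word \<open>xs\<close>, which has at most
  \<open>length xs\<close> inversions.\<close>

lemma finite_root_set:
  assumes xs: "xs \<in> lists S" and neg: "\<And>v. v \<in> S \<Longrightarrow> nonpos S (act xs (simple_root v))"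
  shows "finite root_set"
proof -
  let ?B = "(\<lambda>i. act (take i xs) (simple_root (xs ! i))) ` {..<length xs}"
  have pos: "z \<in> ?B" if z: "z \<in> root_set" "nonneg S z" for z
  proof -
    obtain ys x zs where "xs = ys @ x # zs" "z = act ys (simple_root x)"
      using inverted_root[OF xs z] longest_inverts_all[OF xs neg z] by blast
    then show ?thesis by (intro image_eqI[of _ _ "length ys"]) auto
  qed
  have "root_set \<subseteq> ?B \<union> (\<lambda>z t. - z t) ` ?B"
  proof
    fix z assume z: "z \<in> root_set"
    show "z \<in> ?B \<union> (\<lambda>z t. - z t) ` ?B"
    proof (cases "nonneg S z")
      case True
      then show ?thesis using pos z by blast
    next
      case False
      then have "(\<lambda>t. - z t) \<in> ?B"
        using z root_nonneg_or_nonpos by (intro pos minus_in_root_set) auto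
      then show ?thesis by (intro UnI2 image_eqI[of _ _ "\<lambda>t. - z t"]) auto
    qed
  qed
  then show ?thesis by (rule finite_subset) simp
qed

text \<open>In a longest positive extension every sink is inverted, as it could be appended
  otherwise; \<open>inverted_orientation_step\<close> carries this from the sinks to all
  letters.\<close>

lemma maximal_extension_inverts:
  assumes D: "acyclic_orientation D" and xs: "sink_sequence S D xs" "positive_word xs"
    and bound: "\<And>zs. sink_sequence S D (xs @ zs) \<Longrightarrow> positive_word (xs @ zs) \<Longrightarrow> length zs < N"
  obtains zs where "sink_sequence S D (xs @ zs)" "\<And>v. v \<in> S \<Longrightarrow> nonpos S (act (xs @ zs) (simple_root v))"
proof -
  define A where "A zs \<longleftrightarrow> sink_sequence S D (xs @ zs) \<and> positive_word (xs @ zs)" for zs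
  have "\<exists>zs. A zs \<and> (\<forall>y. A y \<longrightarrow> length y \<le> length zs)"
    by (rule ex_has_greatest_nat[of A "[]" length N]) (use xs bound in \<open>auto simp: A_def\<close>)
  then obtain zs where zs: "A zs" "\<And>y. A y \<Longrightarrow> length y \<le> length zs" by blast
  let ?w = "xs @ zs"
  have w: "sink_sequence S D ?w" "positive_word ?w" using zs by (auto simp: A_def)
  have sink: "nonpos S (act ?w (simple_root x))" if x: "is_sink S (final D ?w) x" for x
  proof (rule ccontr)
    assume *: "\<not> nonpos S (act ?w (simple_root x))"
    have "x \<in> S" using x by (simp add: is_sink_def)
    then have "act ?w (simple_root x) \<in> root_set"
      using sink_sequence_lists[OF w(1)] by (intro act_in_root_set simple_root_in)
    then have "nonneg S (act ?w (simple_root x))" using * root_nonneg_or_nonpos by blast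
    then have "A (zs @ [x])"
      using w x positive_word_snoc[of ?w x] by (simp add: A_def sink_sequence_append)
    then show False using zs(2) by force
  qed
  have "nonpos S (act ?w (simple_root v))" if "v \<in> S" for v
    by (rule acyclic_orientation_induct[OF acyclic_orientation_final[OF D w(1)] that])
      (use sink inverted_orientation_step[OF D w] in blast)+
  then show ?thesis using that w by blast
qed

text \<open>Once letter \<open>i\<close> is processed, its inversion remains negative, whereas the
  inversion of a later letter \<open>j\<close> is a simple root just before \<open>j\<close> is
  processed.\<close>

lemma inj_on_inversions:
  assumes "positive_word xs" "xs \<in> lists S"
  shows "inj_on (\<lambda>i. act (take i xs) (simple_root (xs ! i))) {..<length xs}"
proof (rule linorder_inj_onI)
  fix i j assume "i < j" "i \<in> {..<length xs}" "j \<in> {..<length xs}"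
  then have ij: "i < j" "j < length xs" by auto
  define z where "z = act (take i xs) (simple_root (xs ! i))"
  have lists: "take k xs \<in> lists S" for k using assms(2) set_take_subset[of k xs] by auto
  have nth: "xs ! i \<in> S" "xs ! j \<in> S" using assms(2) ij by auto
  have z: "z \<in> root_set" using nth lists act_in_root_set by (simp add: z_def)
  have "xs = take i xs @ xs ! i # drop (Suc i) xs" using ij by (simp add: id_take_nth_drop)
  then have "nonneg S z" using assms(1) unfolding positive_word_def z_def by blast
  have Suc: "take (Suc i) xs = take i xs @ [xs ! i]" using ij by (simp add: take_Suc_conv_app_nth)
  have "act (rev (take (Suc i) xs)) z = (\<lambda>t. - simple_root (xs ! i) t)"
    using lists[of i] nth by (simp add: z_def Suc reflect_simple_self)
  then have neg: "nonpos S (act (rev (take (Suc i) xs)) z)"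
    by (simp add: nonneg_simple_root)
  define zs where "zs = drop (Suc i) (take j xs)"
  have tj: "take (Suc i) xs @ zs = take j xs"
    using ij append_take_drop_id[of "Suc i" "take j xs"] by (simp add: zs_def min_def)
  have "positive_word (take j xs)" using assms(1) positive_word_prefix[of "take j xs" "drop j xs"] by simp
  then have "nonpos S (act (rev (take j xs)) z)"
    using inverted_stays_inverted[of "take (Suc i) xs" zs z] tj lists z \<open>nonneg S z\<close> neg by simp
  moreover have "act (rev (take j xs)) (act (take j xs) (simple_root (xs ! j))) = simple_root (xs ! j)"
    using lists[of j] by simp
  ultimately show "act (take i xs) (simple_root (xs ! i)) \<noteq> act (take j xs) (simple_root (xs ! j))"
    using root_not_both[of "simple_root (xs ! j)"] nonneg_simple_root[of S "xs ! j"] nth unfolding z_def by auto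
qed auto

section \<open>Letter counts and words avoiding a letter\<close>

lemma count_list_adjacent:
  assumes "acyclic_orientation D" "sink_sequence S D xs" "(u, v) \<in> D"
  shows "count_list xs u \<le> count_list xs v \<and> count_list xs v \<le> Suc (count_list xs u)"
  using assms
proof (induction xs arbitrary: D u v)
  case (Cons x xs)
  have D': "acyclic_orientation (reverse_at x D)" "sink_sequence S (reverse_at x D) xs" "is_sink S D x"
    using Cons.prems acyclic_orientation_reverse by auto
  have "x \<noteq> u" using D' Cons.prems by (auto simp: is_sink_def)
  have "u \<noteq> v" using acyclic_orientation_edges[OF Cons.prems(1,3)] edgesD by blast
  show ?case
  \<comment> \<open>Processing the target flips the arrow, so the two ends of an edge take turns,
    the target first.\<close>
  proof (cases "x = v")
    case True
    then have "(v, u) \<in> reverse_at x D" using Cons.prems by (simp add: reverse_at_def)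
    then show ?thesis using Cons.IH[OF D'(1,2)] True \<open>u \<noteq> v\<close> by fastforce
  next
    case False
    then have "(u, v) \<in> reverse_at x D" using Cons.prems \<open>x \<noteq> u\<close> by (simp add: reverse_at_def)
    then show ?thesis using Cons.IH[OF D'(1,2)] False \<open>x \<noteq> u\<close> by auto
  qed
qed simp

lemma count_list_bounded:
  assumes "(x, v) \<in> edges\<^sup>*"
  shows "\<exists>N. \<forall>D xs. acyclic_orientation D \<longrightarrow> sink_sequence S D xs \<longrightarrow> x \<notin> set xs \<longrightarrow> count_list xs v \<le> N"
  using assms
proof (induction rule: rtrancl_induct)
  case base
  show ?case by (auto simp: count_list_0_iff)
next
  case (step u v)
  then obtain N where N: "\<And>D xs. acyclic_orientation D \<Longrightarrow> sink_sequence S D xs \<Longrightarrow> x \<notin> set xs \<Longrightarrow> count_list xs u \<le> N"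
    by blast
  have "count_list xs v \<le> Suc N" if *: "acyclic_orientation D" "sink_sequence S D xs" "x \<notin> set xs" for D xs
  proof -
    have "(u, v) \<in> D \<or> (v, u) \<in> D" using acyclic_orientation_asym[OF *(1) step.hyps(2)] by blast
    then show ?thesis using count_list_adjacent[OF *(1,2)] N[OF *] by fastforce
  qed
  then show ?case by blast
qed

lemma length_bounded:
  assumes conn: "\<And>v. v \<in> S \<Longrightarrow> (x, v) \<in> edges\<^sup>*"
  obtains N where "\<And>D xs. acyclic_orientation D \<Longrightarrow> sink_sequence S D xs \<Longrightarrow> x \<notin> set xs \<Longrightarrow> length xs < N"
proof -
  have "\<forall>v\<in>S. \<exists>N. \<forall>D xs. acyclic_orientation D \<longrightarrow> sink_sequence S D xs \<longrightarrow> x \<notin> set xs \<longrightarrow> count_list xs v \<le> N"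
    using count_list_bounded conn by blast
  then obtain N where N: "\<And>v D xs. v \<in> S \<Longrightarrow> acyclic_orientation D \<Longrightarrow> sink_sequence S D xs \<Longrightarrow>
      x \<notin> set xs \<Longrightarrow> count_list xs v \<le> N v"
    by metis
  have "length xs < Suc (sum N S)" if *: "acyclic_orientation D" "sink_sequence S D xs" "x \<notin> set xs" for D xs
  proof -
    have "set xs \<subseteq> S" using sink_sequence_lists[OF *(2)] by auto
    then have "length xs = (\<Sum>v\<in>S. count_list xs v)" using finite_S sum_count_set by metis
    also have "\<dots> \<le> sum N S" using N * by (intro sum_mono) blast
    finally show ?thesis by simp
  qed
  then show ?thesis using that by blast
qed

text \<open>Until \<open>x\<close> is processed it remains a sink. Two sinks are never adjacent, so
  the reflections applied meanwhile fix its simple root.\<close>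

lemma act_fixes_sink:
  assumes "acyclic_orientation D" "is_sink S D x" "sink_sequence S D xs" "x \<notin> set xs"
  shows "act xs (simple_root x) = simple_root x"
  using assms
proof (induction xs arbitrary: D)
  case (Cons y xs)
  have y: "is_sink S D y" "y \<noteq> x" "x \<in> S" "y \<in> S" using Cons.prems by (auto simp: is_sink_def)
  have "is_sink S (reverse_at y D) x"
    using Cons.prems y by (auto simp: is_sink_def reverse_at_def split: if_splits)
  then have "act xs (simple_root x) = simple_root x"
    using Cons.prems acyclic_orientation_reverse by (intro Cons.IH[of "reverse_at y D"]) auto
  moreover have "(y, x) \<notin> edges"
    using acyclic_orientation_asym[OF Cons.prems(1), of y x] y Cons.prems by (auto simp: is_sink_def)
  then have "reflect y (simple_root x) = simple_root x"
    using y b_nonedge[of y x] by (simp add: reflect_def)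
  ultimately show ?case by simp
qed simp

text \<open>A positive extension cannot process \<open>x\<close>: up to its first occurrence the
  root of \<open>x\<close> is unchanged, hence still negative. Extensions avoiding \<open>x\<close>
  have bounded length, and a maximal one inverts all letters.\<close>

lemma inverted_sink_imp_finite:
  assumes conn: "\<And>v. v \<in> S \<Longrightarrow> (x, v) \<in> edges\<^sup>*"
    and D: "acyclic_orientation D" and xs: "sink_sequence S D xs" "positive_word xs"
    and x: "is_sink S (final D xs) x" "nonpos S (act xs (simple_root x))"
  shows "finite root_set"
proof -
  have D': "acyclic_orientation (final D xs)" using acyclic_orientation_final D xs by blast
  have xS: "x \<in> S" "xs \<in> lists S" using x xs sink_sequence_lists by (auto simp: is_sink_def)
  obtain N where N: "\<And>D xs. acyclic_orientation D \<Longrightarrow> sink_sequence S D xs \<Longrightarrow> x \<notin> set xs \<Longrightarrow> length xs < N"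
    using length_bounded conn by blast
  have "length zs < N" if zs: "sink_sequence S D (xs @ zs)" "positive_word (xs @ zs)" for zs
  proof (rule N[OF D'])
    show "sink_sequence S (final D xs) zs" using zs by (simp add: sink_sequence_append)
    show "x \<notin> set zs"
    proof
      assume "x \<in> set zs"
      then obtain as bs where as: "zs = as @ x # bs" "x \<notin> set as" by (meson split_list_first)
      then have "act as (simple_root x) = simple_root x"
        using zs act_fixes_sink[OF D' x(1), of as] by (simp add: sink_sequence_append)
      moreover have "nonneg S (act (xs @ as) (simple_root x))"
        using zs as unfolding positive_word_def by (metis append.assoc)
      ultimately show False
        using x xS root_not_both[of "act xs (simple_root x)"] act_in_root_set by simp
    qed
  qed
  then obtain zs where "sink_sequence S D (xs @ zs)" "\<And>v. v \<in> S \<Longrightarrow> nonpos S (act (xs @ zs) (simple_root v))"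
    using maximal_extension_inverts[OF D xs] by blast
  then show ?thesis using finite_root_set sink_sequence_lists by blast
qed

text \<open>The first negative inversion would come from an inverted sink after a positive
  word.\<close>

lemma infinite_imp_positive_word:
  assumes conn: "\<And>u v. u \<in> S \<Longrightarrow> v \<in> S \<Longrightarrow> (u, v) \<in> edges\<^sup>*"
    and inf: "infinite root_set" and D: "acyclic_orientation D" and xs: "sink_sequence S D xs"
  shows "positive_word xs"
  using xs
proof (induction xs rule: rev_induct)
  case (snoc x xs)
  then have xs: "sink_sequence S D xs" "positive_word xs" "is_sink S (final D xs) x"
    by (auto simp: sink_sequence_append)
  then have "x \<in> S" by (simp add: is_sink_def)
  then have "\<not> nonpos S (act xs (simple_root x))"
    using inverted_sink_imp_finite[OF conn D xs] inf by blast
  moreover have "act xs (simple_root x) \<in> root_set"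
    using sink_sequence_lists[OF xs(1)] \<open>x \<in> S\<close> by (intro act_in_root_set simple_root_in)
  ultimately show ?case using xs root_nonneg_or_nonpos by auto
qed simp

text \<open>After a longest word avoiding \<open>x\<close> there is still a sink, and it can only be
  \<open>x\<close>.\<close>

lemma sink_recurs:
  assumes conn: "\<And>v. v \<in> S \<Longrightarrow> (x, v) \<in> edges\<^sup>*" and x: "x \<in> S" and D: "acyclic_orientation D"
  obtains zs where "x \<notin> set zs" "sink_sequence S D (zs @ [x])"
proof -
  obtain N where N: "\<And>D xs. acyclic_orientation D \<Longrightarrow> sink_sequence S D xs \<Longrightarrow> x \<notin> set xs \<Longrightarrow> length xs < N"
    using length_bounded conn by blast
  define A where "A zs \<longleftrightarrow> sink_sequence S D zs \<and> x \<notin> set zs" for zs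
  have "\<exists>zs. A zs \<and> (\<forall>y. A y \<longrightarrow> length y \<le> length zs)"
    by (rule ex_has_greatest_nat[of A "[]" length N]) (use N[OF D] in \<open>auto simp: A_def\<close>)
  then obtain zs where zs: "A zs" "\<And>y. A y \<Longrightarrow> length y \<le> length zs" by blast
  then obtain y where y: "is_sink S (final D zs) y"
    using sink_exists[OF acyclic_orientation_final[OF D]] x by (auto simp: A_def)
  then have w: "sink_sequence S D (zs @ [y])" using zs by (simp add: A_def sink_sequence_append)
  then have "y = x" using zs(1) zs(2)[of "zs @ [y]"] by (auto simp: A_def)
  then show ?thesis using that w zs by (auto simp: A_def)
qed

section \<open>Preprojective roots\<close>

lemma act_other_coordinate: "x \<notin> set zs \<Longrightarrow> act zs v x = v x"
  by (induction zs) (auto simp: reflect_def simple_root_def)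

text \<open>Here \<open>xs\<close> lists the letters as they are processed, so the admissible word
  in reading order is \<open>rev xs\<close>.\<close>

definition preprojective_set :: "('w \<times> 'w) set \<Rightarrow> ('w \<Rightarrow> real) set" where
  "preprojective_set D = {z \<in> root_set. nonneg S z \<and> (\<exists>xs. sink_sequence S D xs \<and> nonpos S (act (rev xs) z))}"

text \<open>The Euler form against the simple root at a source reads off a coordinate. If that simple root
  were an inversion of an admissible word, continuing the word to the next occurrence of the same
  letter would give a positive root at which this coordinate is \<open>-1\<close>.\<close>
lemma source_not_preprojective:
  assumes conn: "\<And>u v. u \<in> S \<Longrightarrow> v \<in> S \<Longrightarrow> (u, v) \<in> edges\<^sup>*"
    and inf: "infinite root_set" and D: "acyclic_orientation D"
    and s: "s \<in> S" "\<And>t. (t, s) \<notin> D"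
  shows "simple_root s \<notin> preprojective_set D"
proof
  assume "simple_root s \<in> preprojective_set D"
  then obtain xs where xs: "sink_sequence S D xs" "nonpos S (act (rev xs) (simple_root s))"
    by (auto simp: preprojective_set_def)
  then obtain ys x zs where eq: "xs = ys @ x # zs" "simple_root s = act ys (simple_root x)"
    using inverted_root[OF sink_sequence_lists simple_root_in[OF s(1)] nonneg_simple_root] by metis
  have ys: "sink_sequence S D (ys @ [x])" using xs eq by (simp add: sink_sequence_append)
  then have l: "ys \<in> lists S" "x \<in> S" using sink_sequence_lists by fastforce+
  obtain as where as: "x \<notin> set as" "sink_sequence S (final D (ys @ [x])) (as @ [x])"
    using sink_recurs[OF conn l(2) acyclic_orientation_final[OF D ys]] l(2) by blast
  let ?w = "(ys @ [x]) @ as"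
  define z where "z = act ?w (simple_root x)"
  have w: "sink_sequence S D (?w @ [x])"
    using ys as by (simp add: sink_sequence_append)
  then have "positive_word (?w @ [x])" using infinite_imp_positive_word[OF conn inf D] by blast
  then have "nonneg S z" unfolding positive_word_snoc z_def by blast
  moreover have "euler_form D z (simple_root s) = z s"
    using euler_form_source_right s by blast
  \<comment> \<open>The prefix \<open>ys @ [x]\<close> of \<open>?w\<close> cancels. The letters of
    \<open>as\<close> differ from \<open>x\<close> and leave the coordinate 1 at \<open>x\<close>
    unchanged.\<close>
  moreover have "euler_form D z (simple_root s) = - act as (simple_root x) x"
    unfolding eq(2) euler_form_root[OF D ys] using l by (simp add: z_def)
  ultimately show False
    using s act_other_coordinate[OF as(1), of "simple_root x"] by (auto simp: nonneg_def simple_root_def)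
qed

text \<open>A sink always exists, so admissible words have arbitrary length; they are positive, and
  their inversions are distinct preprojective roots.\<close>

lemma infinite_preprojective_set:
  assumes conn: "\<And>u v. u \<in> S \<Longrightarrow> v \<in> S \<Longrightarrow> (u, v) \<in> edges\<^sup>*"
    and inf: "infinite root_set" and D: "acyclic_orientation D"
  shows "infinite (preprojective_set D)"
proof
  assume fin: "finite (preprojective_set D)"
  have "S \<noteq> {}" using inf by (auto simp: root_set_def)
  have "\<exists>xs. sink_sequence S D xs \<and> length xs = n" for n
  proof (induction n)
    case (Suc n)
    then obtain xs where xs: "sink_sequence S D xs" "length xs = n" by blast
    obtain x where "is_sink S (final D xs) x"
      using sink_exists acyclic_orientation_final[OF D xs(1)] \<open>S \<noteq> {}\<close> by blast
    then show ?case using xs by (intro exI[of _ "xs @ [x]"]) (simp add: sink_sequence_append)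
  qed auto
  then obtain xs where xs: "sink_sequence S D xs" "length xs = Suc (card (preprojective_set D))" by blast
  have l: "xs \<in> lists S" using xs sink_sequence_lists by blast
  have pos: "positive_word xs" using infinite_imp_positive_word[OF conn inf D xs(1)] .
  have "act (take i xs) (simple_root (xs ! i)) \<in> preprojective_set D" if i: "i < length xs" for i
  proof -
    let ?z = "act (take i xs) (simple_root (xs ! i))"
    have dec: "xs = take i xs @ xs ! i # drop (Suc i) xs" using i by (simp add: id_take_nth_drop)
    then have "nonneg S ?z" using pos unfolding positive_word_def by blast
    moreover have li: "take i xs \<in> lists S" "xs ! i \<in> S" using l i set_take_subset[of i xs] by auto
    then have "?z \<in> root_set" using act_in_root_set simple_root_in by blast
    moreover have "sink_sequence S D (take i xs @ [xs ! i])"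
      using xs(1) sink_sequence_append[of S D "take i xs @ [xs ! i]" "drop (Suc i) xs"] dec by simp
    moreover have "act (rev (take i xs @ [xs ! i])) ?z = (\<lambda>t. - simple_root (xs ! i) t)"
      using li by (simp add: reflect_simple_self)
    then have "nonpos S (act (rev (take i xs @ [xs ! i])) ?z)"
      by (simp only: nonpos_minus nonneg_simple_root)
    ultimately show ?thesis unfolding preprojective_set_def by blast
  qed
  then have "(\<lambda>i. act (take i xs) (simple_root (xs ! i))) ` {..<length xs} \<subseteq> preprojective_set D"
    by blast
  then have "card {..<length xs} \<le> card (preprojective_set D)"
    using card_inj_on_le[OF inj_on_inversions[OF pos l] _ fin] by blast
  then show False using xs by simp
qed

text \<open>Distinctness of inversions bounds the length of positive words by the number of roots. A
  maximal positive word, extending the empty one, inverts every letter and hence every positive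
  root.\<close>

lemma finite_imp_all_preprojective:
  assumes fin: "finite root_set" and D: "acyclic_orientation D"
  shows "{z \<in> root_set. nonneg S z} \<subseteq> preprojective_set D"
proof -
  have "length xs < Suc (card root_set)" if xs: "sink_sequence S D ([] @ xs)" "positive_word ([] @ xs)" for xs
  proof -
    have l: "xs \<in> lists S" using xs sink_sequence_lists[of S D xs] by simp
    then have "take i xs \<in> lists S" for i using set_take_subset[of i xs] by auto
    then have "(\<lambda>i. act (take i xs) (simple_root (xs ! i))) ` {..<length xs} \<subseteq> root_set"
      using l act_in_root_set by auto
    then have "card {..<length xs} \<le> card root_set"
      using card_inj_on_le[OF inj_on_inversions[OF _ l] _ fin] xs by simp
    then show ?thesis by simp
  qed
  then obtain xs where "sink_sequence S D ([] @ xs)" "\<And>v. v \<in> S \<Longrightarrow> nonpos S (act ([] @ xs) (simple_root v))"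
    using maximal_extension_inverts[OF D, of "[]"] by auto
  then have "sink_sequence S D xs" "\<And>v. v \<in> S \<Longrightarrow> nonpos S (act xs (simple_root v))"
    by auto
  then show ?thesis
    using longest_inverts_all sink_sequence_lists unfolding preprojective_set_def by blast
qed

text \<open>Each condition is compared with finiteness of the set of roots; in the infinite case the
  simple root at a source violates the two inclusions.\<close>

lemma preprojective_set_equivalences:
  assumes conn: "\<And>u v. u \<in> S \<Longrightarrow> v \<in> S \<Longrightarrow> (u, v) \<in> edges\<^sup>*" and D: "acyclic_orientation D"
  shows "finite (preprojective_set D) \<longleftrightarrow> finite root_set"
    and "{z \<in> root_set. nonneg S z} \<subseteq> preprojective_set D \<longleftrightarrow> finite root_set"
    and "simple_root ` S \<subseteq> preprojective_set D \<longleftrightarrow> finite root_set"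
proof -
  have "preprojective_set D \<subseteq> root_set" by (auto simp: preprojective_set_def)
  then show "finite (preprojective_set D) \<longleftrightarrow> finite root_set"
    using infinite_preprojective_set[OF conn _ D] finite_subset by blast
  have simple: "simple_root ` S \<subseteq> {z \<in> root_set. nonneg S z}"
    using nonneg_simple_root by auto
  have "finite root_set" if d: "simple_root ` S \<subseteq> preprojective_set D"
  proof (rule ccontr)
    assume inf: "infinite root_set"
    then have "S \<noteq> {}" by (auto simp: root_set_def)
    then obtain s where "s \<in> S" "\<And>t. (t, s) \<notin> D" using source_exists[OF D] by blast
    then show False using source_not_preprojective[OF conn inf D] d by blast
  qed
  then show "{z \<in> root_set. nonneg S z} \<subseteq> preprojective_set D \<longleftrightarrow> finite root_set"
    and "simple_root ` S \<subseteq> preprojective_set D \<longleftrightarrow> finite root_set"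
    using finite_imp_all_preprojective[OF _ D] simple by blast+
qed

end

section \<open>From vertices to generators\<close>

lemma mem_map_prod_image_iff:
  assumes "inj_on f V" "E \<subseteq> V \<times> V" "a \<in> V" "b \<in> V"
  shows "(f a, f b) \<in> map_prod f f ` E \<longleftrightarrow> (a, b) \<in> E"
  using inj_on_image_mem_iff[OF map_prod_inj_on[OF assms(1,1)], of "(a, b)" E] assms(2-4) by auto

lemma reverse_at_map_prod:
  assumes "inj_on f V" "D \<subseteq> V \<times> V" "x \<in> V"
  shows "reverse_at (f x) (map_prod f f ` D) = map_prod f f ` reverse_at x D"
proof -
  have rev: "reverse_at x D \<subseteq> V \<times> V"
    using assms(2) by (auto simp: reverse_at_def split: if_splits)
  have eq: "(f a, f b) \<in> reverse_at (f x) (map_prod f f ` D) \<longleftrightarrow> (f a, f b) \<in> map_prod f f ` reverse_at x D"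
    if "a \<in> V" "b \<in> V" for a b
    using that mem_map_prod_image_iff[OF assms(1,2)] mem_map_prod_image_iff[OF assms(1) rev] inj_on_eq_iff[OF assms(1)] assms(3)
    by (simp add: reverse_at_def)
  have sub: "reverse_at (f x) (map_prod f f ` D) \<subseteq> f ` V \<times> f ` V" "map_prod f f ` reverse_at x D \<subseteq> f ` V \<times> f ` V"
    using assms(2) rev by (auto simp: reverse_at_def split: if_splits)
  show ?thesis
  proof (rule Set.set_eqI)
    fix p
    show "p \<in> reverse_at (f x) (map_prod f f ` D) \<longleftrightarrow> p \<in> map_prod f f ` reverse_at x D"
    proof (cases "p \<in> f ` V \<times> f ` V")
      case True
      then obtain a b where "p = (f a, f b)" "a \<in> V" "b \<in> V" by auto
      then show ?thesis using eq by simp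
    next
      case False
      then show ?thesis using sub by blast
    qed
  qed
qed

lemma sink_sequence_map:
  assumes "inj_on f V" "D \<subseteq> V \<times> V" "xs \<in> lists V"
  shows "sink_sequence (f ` V) (map_prod f f ` D) (map f xs) \<longleftrightarrow> sink_sequence V D xs"
  using assms(2,3)
proof (induction xs arbitrary: D)
  case (Cons x xs)
  have x: "x \<in> V" using Cons.prems by simp
  have "(\<exists>y. (f x, y) \<in> map_prod f f ` D) \<longleftrightarrow> (\<exists>y. (x, y) \<in> D)"
  proof
    assume "\<exists>y. (f x, y) \<in> map_prod f f ` D"
    then obtain a b where "f x = f a" "(a, b) \<in> D" by auto
    then show "\<exists>y. (x, y) \<in> D"
      using assms(1) x Cons.prems(1) by (auto dest: inj_onD)
  next
    assume "\<exists>y. (x, y) \<in> D"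
    then show "\<exists>y. (f x, y) \<in> map_prod f f ` D" by force
  qed
  then have "is_sink (f ` V) (map_prod f f ` D) (f x) \<longleftrightarrow> is_sink V D x"
    using imageI[OF x, of f] x unfolding is_sink_def by metis
  moreover have "reverse_at x D \<subseteq> V \<times> V"
    using Cons.prems by (auto simp: reverse_at_def split: if_splits)
  ultimately show ?case
    using Cons reverse_at_map_prod[OF assms(1), of D x] by simp
qed simp

section \<open>The definitions in terms of words over the generators\<close>

context finite_coxeter_system
begin

lemma roots_eq: "roots G S m = root_set"
proof -
  have "roots G S m = {geometric_action G S m (P u) (simple_root s) | u s. u \<in> lists S \<and> s \<in> S}"
    unfolding roots_def carrier_eq by blast
  also have "\<dots> = root_set"
    unfolding root_set_def using geometric_action_P simple_root_space by (metis (no_types, opaque_lifting))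
  finally show ?thesis .
qed

lemma positive_roots_eq: "positive_roots G S m = {z \<in> root_set. nonneg S z}"
  by (simp add: positive_roots_def roots_eq nonneg_def)

lemma negative_roots_eq: "negative_roots G S m = {z \<in> root_set. nonpos S z}"
  by (simp add: negative_roots_def roots_eq nonpos_def)

text \<open>Distinct nonadjacent letters have \<open>m\<close> equal to 2, and the braid relation of
  length 2 is commutation.\<close>

lemma P_map_cong:
  assumes "bij_betw \<rho> V0 S" "(u, v) \<in> graph_congruence m V0 \<rho>"
  shows "P (map \<rho> u) = P (map \<rho> v) \<and> u \<in> lists V0 \<and> v \<in> lists V0"
  using assms(2)
proof (induction rule: monoid_congruence.induct)
  case (base u v)
  then obtain x y where xy: "u = [x, y]" "v = [y, x]" "x \<in> V0" "y \<in> V0" "x \<noteq> y"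
      "(x, y) \<notin> coxeter_edges m V0 \<rho>"
    by (auto simp: graph_relations_def)
  have S: "\<rho> x \<in> S" "\<rho> y \<in> S" using xy assms(1) by (auto dest: bij_betwE)
  moreover have "\<rho> x \<noteq> \<rho> y" using xy assms(1) by (auto simp: bij_betw_def inj_on_def)
  ultimately have "m (\<rho> x) (\<rho> y) = enat 2"
    using m_ge[of "\<rho> x" "\<rho> y"] xy by (auto simp: coxeter_edges_def numeral_eq_enat)
  moreover have "alternating a b 2 = [b, a]" for a b :: 'w
    by (simp add: numeral_2_eq_2)
  ultimately show ?case
    using P_alternating[of "\<rho> x" "\<rho> y" 2] S xy by simp
next
  case (mult u v a b)
  have "P (map \<rho> a @ map \<rho> u @ map \<rho> b) = P (map \<rho> a @ map \<rho> v @ map \<rho> b)"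
    by (intro P_append_cong) (use mult assms(1) in \<open>auto dest: bij_betwE\<close>)
  then show ?case using mult by auto
qed auto

text \<open>All words of a class have one value, so \<open>the_elem\<close> is applied to a
  singleton.\<close>

lemma induced_hom_eq:
  assumes "bij_betw \<rho> V0 S" "X \<in> carrier (graph_monoid m V0 \<rho>)" "x \<in> X"
  shows "induced_hom G \<rho> X = P (map \<rho> x) \<and> x \<in> lists V0"
proof -
  obtain w where w: "X = graph_congruence m V0 \<rho> `` {w}" "w \<in> lists V0"
    using assms(2) by (auto simp: graph_monoid_def quotient_def)
  have X: "P (map \<rho> y) = P (map \<rho> w) \<and> y \<in> lists V0" if "y \<in> X" for y
    using P_map_cong[OF assms(1), of w y] that w by simp
  have "(\<lambda>y. P (map \<rho> y)) ` X = {P (map \<rho> x)}"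
    using X assms(3) by auto
  then show ?thesis using X[OF assms(3)] by (simp add: induced_hom_def)
qed

text \<open>The homomorphism can be evaluated at the representative that is admissible; conversely a
  sink sequence over \<open>S\<close> lifts letter by letter through the inverse of
  \<open>\<rho>\<close>.\<close>

lemma preprojective_roots_eq:
  assumes \<rho>: "bij_betw \<rho> V0 S" and D0: "c_orientation G S m V0 \<rho> c \<subseteq> V0 \<times> V0"
  shows "preprojective_roots G S m V0 \<rho> c = preprojective_set (map_prod \<rho> \<rho> ` c_orientation G S m V0 \<rho> c)"
proof -
  let ?O = "c_orientation G S m V0 \<rho> c"
  let ?D = "map_prod \<rho> \<rho> ` ?O"
  have inj: "inj_on \<rho> V0" "\<rho> ` V0 = S" using \<rho> by (auto simp: bij_betw_def)
  have "(\<exists>X\<in>admissible_elements G S m V0 \<rho> c. geometric_action G S m (induced_hom G \<rho> X) z \<in> negative_roots G S m)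
      \<longleftrightarrow> (\<exists>xs. sink_sequence S ?D xs \<and> nonpos S (act (rev xs) z))" (is "?L \<longleftrightarrow> ?R")
    if z: "z \<in> root_set" for z
  proof
    assume ?L
    then obtain X x where X: "X \<in> carrier (graph_monoid m V0 \<rho>)" "x \<in> X" "sink_sequence V0 ?O (rev x)"
      "nonpos S (geometric_action G S m (induced_hom G \<rho> X) z)"
      by (auto simp: admissible_elements_def admissible_word_def negative_roots_eq)
    have x: "x \<in> lists V0" "induced_hom G \<rho> X = P (map \<rho> x)"
      using induced_hom_eq[OF \<rho> X(1,2)] by auto
    have "sink_sequence S ?D (map \<rho> (rev x))"
      using sink_sequence_map[OF inj(1) D0, of "rev x"] x X inj(2) by simp
    moreover have "map \<rho> x \<in> lists S" using x inj by auto
    then have "nonpos S (act (rev (map \<rho> (rev x))) z)"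
      using X x z by (simp add: geometric_action_P root_root_space rev_map)
    ultimately show ?R by blast
  next
    assume ?R
    then obtain xs where xs: "sink_sequence S ?D xs" "nonpos S (act (rev xs) z)" by blast
    then have l: "xs \<in> lists S" using sink_sequence_lists by blast
    \<comment> \<open>The reversal passes from processing order to reading order.\<close>
    define x where "x = rev (map (inv_into V0 \<rho>) xs)"
    have x: "x \<in> lists V0" using l inj by (auto simp: x_def inv_into_into)
    have rho_x: "map \<rho> (rev x) = xs"
      using l inj by (auto simp: x_def f_inv_into_f intro!: map_idI)
    define X where "X = graph_congruence m V0 \<rho> `` {x}"
    have X: "X \<in> carrier (graph_monoid m V0 \<rho>)" "x \<in> X"
      using x by (auto simp: X_def graph_monoid_def quotient_def intro!: monoid_congruence.refl)
    have "sink_sequence V0 ?O (rev x)"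
      using sink_sequence_map[OF inj(1) D0, of "rev x"] x xs inj(2) rho_x by simp
    then have "X \<in> admissible_elements G S m V0 \<rho> c"
      using X by (auto simp: admissible_elements_def admissible_word_def)
    moreover have "map \<rho> x = rev xs" using rho_x by (metis rev_map rev_rev_ident)
    then have "geometric_action G S m (induced_hom G \<rho> X) z = act (rev xs) z"
      using induced_hom_eq[OF \<rho> X] l z by (simp add: geometric_action_P root_root_space)
    then have "geometric_action G S m (induced_hom G \<rho> X) z \<in> negative_roots G S m"
      using xs l z act_in_root_set by (simp add: negative_roots_eq)
    ultimately show ?L by blast
  qed
  then show ?thesis
    by (auto simp: preprojective_roots_def preprojective_set_def positive_roots_eq)
qed

lemma map_word_orientation:
  assumes "bij_betw \<rho> V0 S"
  shows "map_prod \<rho> \<rho> ` word_orientation m V0 \<rho> ss = word_orientation m S (\<lambda>s. s) ss"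
proof -
  have inj: "inj_on \<rho> V0" "\<rho> ` V0 = S" using assms by (auto simp: bij_betw_def)
  show ?thesis
  proof
    show "map_prod \<rho> \<rho> ` word_orientation m V0 \<rho> ss \<subseteq> word_orientation m S (\<lambda>s. s) ss"
      using inj by (auto simp: word_orientation_def coxeter_edges_def dest: inj_onD)
    show "word_orientation m S (\<lambda>s. s) ss \<subseteq> map_prod \<rho> \<rho> ` word_orientation m V0 \<rho> ss"
    proof
      fix p assume "p \<in> word_orientation m S (\<lambda>s. s) ss"
      moreover obtain s t where "p = (s, t)" by fastforce
      ultimately have p: "p = (s, t)" "s \<in> S" "t \<in> S" "(s, t) \<in> word_orientation m S (\<lambda>s. s) ss"
        by (auto simp: word_orientation_def coxeter_edges_def)
      then obtain x y where "s = \<rho> x" "t = \<rho> y" "x \<in> V0" "y \<in> V0" using inj by blast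
      then show "p \<in> map_prod \<rho> \<rho> ` word_orientation m V0 \<rho> ss"
        using p by (intro image_eqI[of _ _ "(x, y)"]) (auto simp: word_orientation_def coxeter_edges_def)
    qed
  qed
qed

lemma acyclic_orientation_word:
  assumes ss: "distinct ss" "set ss = S"
  shows "acyclic_orientation (word_orientation m S (\<lambda>s. s) ss)"
proof -
  let ?D = "word_orientation m S (\<lambda>s. s) ss"
  \<comment> \<open>Arrows point to the right in \<open>ss\<close>, so the distance to the right end
    is a height. The least index is the position of the letter, as \<open>ss\<close> has no
    repetitions.\<close>
  define f where "f x = length ss - (LEAST i. ss ! i = x)" for x
  have f: "f (ss ! i) = length ss - i" if "i < length ss" for i
  proof -
    have "(LEAST k. ss ! k = ss ! i) = i"
    proof (rule Least_equality)
      fix k assume "ss ! k = ss ! i"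
      then show "i \<le> k" using ss(1) that nth_eq_iff_index_eq[of ss k i] by linarith
    qed simp
    then show ?thesis by (simp add: f_def)
  qed
  have "f t < f s" if "(s, t) \<in> ?D" for s t
    using that f by (force simp: word_orientation_def)
  moreover have "(s, t) \<in> ?D \<longleftrightarrow> (t, s) \<notin> ?D" if e: "(s, t) \<in> edges" for s t
  proof -
    obtain i j where ij: "i < length ss" "s = ss ! i" "j < length ss" "t = ss ! j"
      using edgesD[OF e] ss(2) by (metis in_set_conv_nth)
    have "i \<noteq> j" using edgesD[OF e] ij by auto
    then show ?thesis
      using e edges_sym[OF e] ij ss(1)
      by (auto simp: word_orientation_def nth_eq_iff_index_eq) (metis linorder_neqE_nat nth_eq_iff_index_eq order.strict_trans order.asym)+
  qed
  moreover have "?D \<subseteq> edges" by (auto simp: word_orientation_def)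
  ultimately show ?thesis unfolding acyclic_orientation_def by blast
qed

lemma irreducible_connected:
  assumes "bij_betw \<rho> V0 S" "coxeter_irreducible m V0 \<rho>" "s \<in> S" "t \<in> S"
  shows "(s, t) \<in> edges\<^sup>*"
proof -
  obtain x y where xy: "x \<in> V0" "y \<in> V0" "s = \<rho> x" "t = \<rho> y"
    using assms by (auto simp: bij_betw_def)
  have step: "(\<rho> a, \<rho> b) \<in> edges" if "(a, b) \<in> coxeter_edges m V0 \<rho>" for a b
    using that assms(1) by (auto simp: coxeter_edges_def bij_betw_def inj_on_def)
  have "(x, y) \<in> (coxeter_edges m V0 \<rho>)\<^sup>*"
    using assms(2) xy by (auto simp: coxeter_irreducible_def)
  then have "(\<rho> x, \<rho> y) \<in> edges\<^sup>*"
    by (induction rule: rtrancl_induct) (auto intro: rtrancl_into_rtrancl step)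
  then show ?thesis using xy by simp
qed

end

theorem theorem3p1:
  fixes G :: "('w, 'b) monoid_scheme" and S :: "'w set" and m :: "'w \<Rightarrow> 'w \<Rightarrow> enat"
    and V0 :: "'v set" and \<rho> :: "'v \<Rightarrow> 'w" and c :: 'w
  assumes "coxeter_system G S m"
    and "finite S"
    and "bij_betw \<rho> V0 S"
    and "coxeter_irreducible m V0 \<rho>"
    and "coxeter_element G S c"
  shows "(finite (carrier G) \<longleftrightarrow> finite (preprojective_roots G S m V0 \<rho> c))
    \<and> (finite (preprojective_roots G S m V0 \<rho> c)
         \<longleftrightarrow> positive_roots G S m \<subseteq> preprojective_roots G S m V0 \<rho> c)
    \<and> (positive_roots G S m \<subseteq> preprojective_roots G S m V0 \<rho> c
         \<longleftrightarrow> simple_root ` S \<subseteq> preprojective_roots G S m V0 \<rho> c)"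
proof -
  interpret finite_coxeter_system G S m
    using assms(1,2) by unfold_locales
  \<comment> \<open>Names the expression selected in \<open>c_orientation\<close>, which makes the
    orientation that of a concrete word.\<close>
  define ss where "ss = (SOME ss. coxeter_expression G S c ss)"
  have "coxeter_expression G S c ss"
    using assms(5) unfolding ss_def coxeter_element_def by (rule someI_ex)
  then have ss: "distinct ss" "set ss = S" by (auto simp: coxeter_expression_def)
  have D0: "c_orientation G S m V0 \<rho> c = word_orientation m V0 \<rho> ss"
    by (simp add: c_orientation_def ss_def)
  then have "c_orientation G S m V0 \<rho> c \<subseteq> V0 \<times> V0"
    by (auto simp: word_orientation_def coxeter_edges_def)
  then have "preprojective_roots G S m V0 \<rho> c = preprojective_set (word_orientation m S (\<lambda>s. s) ss)"
    using preprojective_roots_eq[OF assms(3)] D0 map_word_orientation[OF assms(3)] by simp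
  then show ?thesis
    using preprojective_set_equivalences[OF irreducible_connected[OF assms(3,4)] acyclic_orientation_word[OF ss]]
      finite_carrier_iff positive_roots_eq by simp
qed

end
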